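(* Let $q\ge5$ be an odd prime power and let $x$ be a point of $\mathbf{W}(q)$. Let $\mathbf{S}(\Pi(x))$ be the set of subgroups of $\mathrm{Aut}(\Pi(x))$ acting sharply transitively on the points of $\Pi(x)$, and let $\mathbf{S}^{\mathbb{S}}(\mathcal{P}(q))$ be the set of Singer groups of $\mathcal{P}(q)$ containing $\mathbb{S}$. Then the map $$\chi:\mathbf{S}(\Pi(x))\to\mathbf{S}^{\mathbb{S}}(\mathcal{P}(q)):K\mapsto\chi(K),$$ where $\overline{K}\le\mathrm{Aut}(\mathbf{W}(q))_x$ is the full preimage of $K$ under the natural map $\mathrm{Aut}(\mathbf{W}(q))_x\to\mathrm{Aut}(\Pi(x))$ and $\chi(K)$ is the automorphism group induced by $\overline{K}$ on $\mathcal{P}(q)$, is a bijection.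
   Context: $\mathbf{W}(q)$ is the symplectic generalized quadrangle of order $q$ (points of $\mathbf{PG}(3,q)$ and totally isotropic lines of a nondegenerate symplectic polarity), and $\mathbb{S}$ is the group (of order $q$) of all symmetries with center $x$, i.e. automorphisms of $\mathbf{W}(q)$ fixing every point of $x^\perp$. $\mathcal{P}(q)$ is the Payne-derived quadrangle: its points are the points of $\mathbf{W}(q)$ not collinear with $x$; its lines are the lines of $\mathbf{W}(q)$ not through $x$ together with the sets $\{x,r\}^{\perp\perp}\setminus\{x\}$, $r\not\sim x$. A Singer group of $\mathcal{P}(q)$ is a subgroup of its automorphism group acting sharply transitively on its points. For $q\ge5$ every automorphism of $\mathcal{P}(q)$ is induced by a unique element of $\mathrm{Aut}(\mathbf{W}(q))_x$, and $\mathbb{S}$ is identified with the group it induces on $\mathcal{P}(q)$. $\Pi(x)$ is the affine plane of order $q$ with points the sets $\{x,z\}^\perp$, $z\not\sim x$, and lines the elements of $x^\perp\setminus\{x\}$, with incidence given by containment; $\mathrm{Aut}(\mathbf{W}(q))_x$ acts naturally on it with kernel $\mathbb{S}$. *)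

theory Defs
  imports "HOL-Analysis.Cartesian_Space" "HOL-Algebra.Bij"
begin

section \<open>Point-line geometries and their automorphism groups\<close>

record ('p, 'l) geometry =
  points :: "'p set"
  lines :: "'l set"
  inc :: "'p \<Rightarrow> 'l \<Rightarrow> bool"

text \<open>
  An automorphism is recorded by its action on the points; it has to extend to a permutation of the
  lines preserving incidence. In every geometry below a line is determined by its set of points, so
  the extension is unique and nothing is lost. The group operation is that of \<^const>\<open>BijGroup\<close>;
  its elements are functions that are \<^const>\<open>undefined\<close> outside the point set.
\<close>

definition automorphisms :: "('p, 'l) geometry \<Rightarrow> ('p \<Rightarrow> 'p) set" where
  "automorphisms \<G> = {\<theta> \<in> Bij (points \<G>). \<exists>\<phi>. bij_betw \<phi> (lines \<G>) (lines \<G>) \<and>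
     (\<forall>p \<in> points \<G>. \<forall>l \<in> lines \<G>. inc \<G> p l \<longleftrightarrow> inc \<G> (\<theta> p) (\<phi> l))}"

definition aut_group :: "('p, 'l) geometry \<Rightarrow> ('p \<Rightarrow> 'p) monoid" where
  "aut_group \<G> = (BijGroup (points \<G>))\<lparr>carrier := automorphisms \<G>\<rparr>"

definition sharply_transitive_on :: "('p \<Rightarrow> 'p) set \<Rightarrow> 'p set \<Rightarrow> bool" where
  "sharply_transitive_on G P \<longleftrightarrow> (\<forall>a \<in> P. \<forall>b \<in> P. \<exists>!g. g \<in> G \<and> g a = b)"

text \<open>For a generalized quadrangle these are its Singer groups.\<close>

definition sharply_transitive_subgroups :: "('p, 'l) geometry \<Rightarrow> ('p \<Rightarrow> 'p) set set" where
  "sharply_transitive_subgroups \<G> =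
     {G. subgroup G (aut_group \<G>) \<and> sharply_transitive_on G (points \<G>)}"

definition collinear_in :: "('p, 'l) geometry \<Rightarrow> 'p \<Rightarrow> 'p \<Rightarrow> bool" where
  "collinear_in \<G> p r \<longleftrightarrow> (\<exists>l \<in> lines \<G>. inc \<G> p l \<and> inc \<G> r l)"

text \<open>
  A point on some line is collinear with itself, so \<open>x \<in> perp \<G> {x}\<close> in a generalized quadrangle.
\<close>

definition perp :: "('p, 'l) geometry \<Rightarrow> 'p set \<Rightarrow> 'p set" where
  "perp \<G> A = {y \<in> points \<G>. \<forall>a \<in> A. collinear_in \<G> y a}"

section \<open>The symplectic quadrangle\<close>

definition symplectic_form :: "('a::field ^ 'n \<Rightarrow> 'a ^ 'n \<Rightarrow> 'a) \<Rightarrow> bool" where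
  "symplectic_form B \<longleftrightarrow>
     (\<forall>u. Vector_Spaces.linear (*s) (*) (B u)) \<and>
     (\<forall>v. Vector_Spaces.linear (*s) (*) (\<lambda>u. B u v)) \<and>
     (\<forall>u. B u u = 0) \<and>
     (\<forall>u. (\<forall>v. B u v = 0) \<longrightarrow> u = 0)"

definition pg_points :: "('a::field ^ 'n) set set" where
  "pg_points = {p. vec.subspace p \<and> vec.dim p = 1}"

text \<open>
  The symplectic polarity is the one given by \<open>B\<close>; with \<open>q\<close> the order of the field, this is W(q).
  A line is represented by the set of projective points on it.
\<close>

definition symplectic_quadrangle ::
    "('a::field ^ 4 \<Rightarrow> 'a ^ 4 \<Rightarrow> 'a) \<Rightarrow> (('a ^ 4) set, ('a ^ 4) set set) geometry" where
  "symplectic_quadrangle B =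
     \<lparr>points = pg_points,
      lines = {{p \<in> pg_points. p \<subseteq> U} | U.
                 vec.subspace U \<and> vec.dim U = 2 \<and> (\<forall>u \<in> U. \<forall>v \<in> U. B u v = 0)},
      inc = (\<in>)\<rparr>"

section \<open>Payne derivation and the affine plane at a point\<close>

definition payne_derived :: "('p, 'p set) geometry \<Rightarrow> 'p \<Rightarrow> ('p, 'p set) geometry" where
  "payne_derived \<G> x =
     \<lparr>points = points \<G> - perp \<G> {x},
      lines = {l \<in> lines \<G>. x \<notin> l} \<union>
              {perp \<G> (perp \<G> {x, r}) - {x} | r. r \<in> points \<G> - perp \<G> {x}},
      inc = (\<in>)\<rparr>"

text \<open>The points of the affine plane are sets of points of \<open>\<G>\<close>, its lines are points of \<open>\<G>\<close>.\<close>

definition plane_at :: "('p, 'l) geometry \<Rightarrow> 'p \<Rightarrow> ('p set, 'p) geometry" where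
  "plane_at \<G> x =
     \<lparr>points = {perp \<G> {x, z} | z. z \<in> points \<G> - perp \<G> {x}},
      lines = perp \<G> {x} - {x},
      inc = (\<lambda>m r. r \<in> m)\<rparr>"

definition symmetries :: "('p, 'l) geometry \<Rightarrow> 'p \<Rightarrow> ('p \<Rightarrow> 'p) set" where
  "symmetries \<G> x = {\<theta> \<in> automorphisms \<G>. \<forall>p \<in> perp \<G> {x}. \<theta> p = p}"

definition aut_stabilizer :: "('p, 'l) geometry \<Rightarrow> 'p \<Rightarrow> ('p \<Rightarrow> 'p) set" where
  "aut_stabilizer \<G> x = {\<theta> \<in> automorphisms \<G>. \<theta> x = x}"

definition plane_action :: "('p, 'l) geometry \<Rightarrow> 'p \<Rightarrow> ('p \<Rightarrow> 'p) \<Rightarrow> ('p set \<Rightarrow> 'p set)" where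
  "plane_action \<G> x \<theta> = restrict (\<lambda>m. \<theta> ` m) (points (plane_at \<G> x))"

definition induced_on_payne :: "('p, 'p set) geometry \<Rightarrow> 'p \<Rightarrow> ('p \<Rightarrow> 'p) set \<Rightarrow> ('p \<Rightarrow> 'p) set" where
  "induced_on_payne \<G> x H = (\<lambda>\<theta>. restrict \<theta> (points (payne_derived \<G> x))) ` H"

definition singer_groups_with_symmetries :: "('p, 'p set) geometry \<Rightarrow> 'p \<Rightarrow> ('p \<Rightarrow> 'p) set set" where
  "singer_groups_with_symmetries \<G> x =
     {G \<in> sharply_transitive_subgroups (payne_derived \<G> x).
        induced_on_payne \<G> x (symmetries \<G> x) \<subseteq> G}"

definition full_preimage :: "('p, 'l) geometry \<Rightarrow> 'p \<Rightarrow> ('p set \<Rightarrow> 'p set) set \<Rightarrow> ('p \<Rightarrow> 'p) set" where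
  "full_preimage \<G> x K = {\<theta> \<in> aut_stabilizer \<G> x. plane_action \<G> x \<theta> \<in> K}"

definition chi :: "('p, 'p set) geometry \<Rightarrow> 'p \<Rightarrow> ('p set \<Rightarrow> 'p set) set \<Rightarrow> ('p \<Rightarrow> 'p) set" where
  "chi \<G> x K = induced_on_payne \<G> x (full_preimage \<G> x K)"

end

theory Submission
  imports Defs
begin

text \<open>
  In coordinates with \<open>x = \<langle>e0\<rangle>\<close> the points of the Payne-derived quadrangle become pairs \<open>(P, c)\<close> of a
  point \<open>P\<close> of the affine plane over the field and a height \<open>c\<close>; two of them are collinear iff they
  lie on a common vertical line or their heights differ by the determinant of their base points.
  The vertical lines are the points of \<open>\<Pi>(x)\<close>. For \<open>q \<ge> 5\<close> collinearity alone tells vertical lines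
  from the others, so every automorphism of the derived quadrangle acts on \<open>\<Pi>(x)\<close>. By the fundamental
  theorem of affine geometry each collineation of \<open>\<Pi>(x)\<close> is semi-affine and hence lifts to a semilinear
  similitude fixing \<open>x\<close>. An automorphism that acts trivially on \<open>\<Pi>(x)\<close> is a vertical translation, that is,
  a symmetry with center \<open>x\<close>. So the stabilizer of \<open>x\<close> is the full automorphism group of the derived
  quadrangle and maps onto that of \<open>\<Pi>(x)\<close>, with kernel acting sharply transitively on each vertical
  line; for such an extension, taking preimages matches the sharply transitive subgroups.
\<close>

section \<open>The coordinate model of the derived quadrangle\<close>

text \<open>Nothing marks the vertical lines inside the derived quadrangle: the quadrangle axioms
  hold equally for both kinds of lines, so an automorphism could a priori mix them. The proof
  therefore needs a finer invariant, the number of centres (common neighbours) of a triad of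
  pairwise noncollinear points. A triad inside a hyperbolic line of \<open>W(q)\<close> can keep all
  \<open>q\<close> affine points of the polar line as centres, while a pair on a vertical line only
  occurs with triads of at most 4 centres. Once the base action is known the heights are rigid:
  along a nonvertical line they differ by a determinant of base points, so an automorphism that is
  trivial on the base can only add one constant everywhere. These constants form the kernel, which
  is sharply transitive on each fibre. Hence a group containing the kernel is sharply transitive on
  points exactly if its image is sharply transitive on fibres.\<close>

definition area :: "'a::field \<times> 'a \<Rightarrow> 'a \<times> 'a \<Rightarrow> 'a" where
  "area u v = fst u * snd v - snd u * fst v"

text \<open>Collinearity of the points \<open>(P, c)\<close> of the derived quadrangle.\<close>

definition heis_adj :: "('a::field \<times> 'a) \<times> 'a \<Rightarrow> ('a \<times> 'a) \<times> 'a \<Rightarrow> bool" where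
  "heis_adj p r \<longleftrightarrow> fst p = fst r \<or> snd r - snd p = area (fst p) (fst r)"

text \<open>Triples with repeated points count as collinear, in agreement with any two points having
  a common line; this keeps distinctness hypotheses out of the later statements.\<close>

definition collin :: "'a::field \<times> 'a \<Rightarrow> 'a \<times> 'a \<Rightarrow> 'a \<times> 'a \<Rightarrow> bool" where
  "collin P R T \<longleftrightarrow> area (R - P) (T - P) = 0"

text \<open>
  Let \<open>p\<close> and \<open>s\<close> be distinct and collinear. The triads \<open>p, r, t\<close> centered by \<open>s\<close> have at most 4 centers
  if \<open>p\<close> and \<open>s\<close> lie on a vertical line; otherwise some such triad, inside a hyperbolic line, has \<open>q\<close>.
  This is where \<open>q \<ge> 5\<close> is needed.
\<close>

lemma vertical_few_centres:
  fixes p r s t :: "('a::{field,finite} \<times> 'a) \<times> 'a"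
  assumes "fst p = fst s" and "heis_adj s r" "heis_adj s t" "\<not> heis_adj p r" "\<not> heis_adj p t" "\<not> heis_adj r t"
  shows "card {n. heis_adj n p \<and> heis_adj n r \<and> heis_adj n t} \<le> 4"
proof -
  obtain P1 P2 c R1 R2 d T1 T2 e f where
    p: "p = ((P1,P2),c)" and r: "r = ((R1,R2),d)" and t: "t = ((T1,T2),e)" and s: "s = ((P1,P2),f)"
    using assms(1) by (metis prod.exhaust fst_conv)
  have nr: "(P1,P2) \<noteq> (R1,R2)" and nt: "(P1,P2) \<noteq> (T1,T2)" and nrt: "(R1,R2) \<noteq> (T1,T2)"
    using assms(4-6) unfolding p r t heis_adj_def by auto
  have npr: "d - c \<noteq> P1 * R2 - P2 * R1"
    using assms(4) unfolding p r heis_adj_def area_def by auto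
  have sr: "d - f = P1 * R2 - P2 * R1" and st: "e - f = P1 * T2 - P2 * T1"
    using assms(2,3) nr nt unfolding s r t heis_adj_def area_def by auto
  \<comment> \<open>\<open>?D\<close> is the determinant of the base triangle. \<open>E\<close>
    collects the centres over none of its vertices; such a centre solves three linear equations,
    with \<open>?D\<close> as determinant once its height is eliminated.\<close>
  let ?D = "(R1 - P1) * (T2 - P2) - (R2 - P2) * (T1 - P1)"
  define E where "E = {n. fst n \<noteq> (P1,P2) \<and> fst n \<noteq> (R1,R2) \<and> fst n \<noteq> (T1,T2) \<and>
     heis_adj n p \<and> heis_adj n r \<and> heis_adj n t}"
  have E: "n = m" if "n \<in> E" "m \<in> E" for n m
  proof -
    obtain a b h a' b' h' where n: "n = ((a,b),h)" and m: "m = ((a',b'),h')" by (metis prod.exhaust)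
    have n1: "c - h = a * P2 - b * P1" "d - h = a * R2 - b * R1" "e - h = a * T2 - b * T1"
      using that(1) unfolding E_def n p r t heis_adj_def area_def by auto
    have m1: "c - h' = a' * P2 - b' * P1" "d - h' = a' * R2 - b' * R1" "e - h' = a' * T2 - b' * T1"
      using that(2) unfolding E_def m p r t heis_adj_def area_def by auto
    \<comment> \<open>If the base points were on a line, neighbours of \<open>n\<close> and
      neighbours of \<open>s\<close> over that line would both have heights varying affinely along
      it. The two affine functions agree over the distinct base points of \<open>r\<close> and
      \<open>t\<close>, but over the base point of \<open>p\<close> and \<open>s\<close> they take
      the values \<open>c\<close> and \<open>f\<close>, which differ because \<open>r\<close> is
      collinear with \<open>s\<close> and not with \<open>p\<close>.\<close>
    have "?D \<noteq> 0"
    proof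
      assume D: "?D = 0"
      show False
      proof (cases "R1 = P1")
        case True
        then have R2: "R2 \<noteq> P2" using nr by auto
        then have "T1 = P1" using D True by auto
        then have "(d - c) * (T2 - P2) = (e - c) * (R2 - P2)"
        proof -
          have "d - c = a * (R2 - P2)" "e - c = a * (T2 - P2)"
            using n1 unfolding True \<open>T1 = P1\<close> by algebra+
          then show ?thesis by simp
        qed
        moreover have "d - c = f - c + P1 * (R2 - P2)" "e - c = f - c + P1 * (T2 - P2)"
          using sr st True \<open>T1 = P1\<close> by (algebra)+
        ultimately have "(f - c) * (T2 - R2) = 0" by algebra
        then show False using npr sr nrt True \<open>T1 = P1\<close> by auto
      next
        case False
        have "(d - c) * (T1 - P1) = (e - c) * (R1 - P1)" using n1 D by algebra
        moreover have "d - c = f - c + (P1 * R2 - P2 * R1)" "e - c = f - c + (P1 * T2 - P2 * T1)"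
          using sr st by (algebra)+
        ultimately have "(f - c) * (T1 - R1) = 0" using D by algebra
        then have "T1 = R1" using npr sr by auto
        then have "(R1 - P1) * (T2 - R2) = 0" using D by (simp add: algebra_simps)
        then have "T2 = R2" using False by simp
        then show False using nrt \<open>T1 = R1\<close> by auto
      qed
    qed
    moreover have "?D * (a - a') = 0" "?D * (b - b') = 0" using n1 m1 by algebra+
    ultimately have ab: "a = a'" "b = b'" by auto
    have "h = c - (c - h)" "h' = c - (c - h')" by simp_all
    then have "h = h'" unfolding n1(1) m1(1) ab by simp
    then show ?thesis using n m ab by simp
  qed
  have Ec: "card E \<le> 1"
    using E by (metis card_le_Suc0_iff_eq One_nat_def finite)
  \<comment> \<open>A centre over the base point of one of the three points is collinear with
    another of them on a nonvertical line, which fixes its height. The first of these candidates is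
    \<open>s\<close>.\<close>
  let ?X = "{((P1,P2), d + R1 * P2 - R2 * P1), ((R1,R2), c + P1 * R2 - P2 * R1), ((T1,T2), c + P1 * T2 - P2 * T1)}"
  have "{n. heis_adj n p \<and> heis_adj n r \<and> heis_adj n t} \<subseteq> ?X \<union> E"
  proof
    fix n assume "n \<in> {n. heis_adj n p \<and> heis_adj n r \<and> heis_adj n t}"
    moreover obtain a b h where "n = ((a,b),h)" by (metis prod.exhaust)
    ultimately show "n \<in> ?X \<union> E"
      using nr nt nrt unfolding E_def p r t heis_adj_def area_def by (auto simp: algebra_simps)
  qed
  then have "card {n. heis_adj n p \<and> heis_adj n r \<and> heis_adj n t} \<le> card (?X \<union> E)"
    by (intro card_mono) auto
  also have "\<dots> \<le> card ?X + card E" by (rule card_Un_le)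
  also have "\<dots> \<le> 3 + 1" using Ec by (intro add_mono) (auto simp: card_insert_if)
  finally show ?thesis by simp
qed

lemma nonvertical_many_centres:
  fixes p s :: "('a::{field,finite} \<times> 'a) \<times> 'a"
  assumes q: "CARD('a) \<ge> 5" and ps: "heis_adj p s" "fst p \<noteq> fst s"
  obtains r t where "heis_adj s r" "heis_adj s t" "\<not> heis_adj p r" "\<not> heis_adj p t" "\<not> heis_adj r t"
    "card {n. heis_adj n p \<and> heis_adj n r \<and> heis_adj n t} > 4"
proof -
  obtain P1 P2 c S1 S2 f where p: "p = ((P1,P2),c)" and s: "s = ((S1,S2),f)" by (metis prod.exhaust)
  have f: "f = c + P1 * S2 - P2 * S1" using ps unfolding p s heis_adj_def area_def by (auto simp: algebra_simps)
  \<comment> \<open>A direction not parallel to the line joining the base points of \<open>p\<close>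
    and \<open>s\<close>.\<close>
  define N1 N2 where "N1 = (if S1 = P1 then 1 else 0 :: 'a)" and "N2 = (if S1 = P1 then 0 else 1 :: 'a)"
  let ?D = "(S1 - P1) * N2 - (S2 - P2) * N1"
  have D: "?D \<noteq> 0" using ps(2) unfolding p s N1_def N2_def by auto
  have N: "N1 \<noteq> 0 \<or> N2 \<noteq> 0" unfolding N1_def N2_def by auto
  have "\<exists>l::'a. l \<notin> {0,1}"
  proof (rule ccontr)
    assume "\<not> ?thesis"
    then have "card (UNIV::'a set) \<le> card {0,1::'a}" by (intro card_mono) auto
    then show False using q by auto
  qed
  then obtain l :: 'a where l: "l \<noteq> 0" "l \<noteq> 1" by auto
  \<comment> \<open>\<open>dd\<close> equals the determinant of the base point of \<open>s\<close>
    and \<open>N\<close>. With this slope \<open>p\<close>, \<open>r\<close>, \<open>t\<close> are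
    the points with parameters 0, 1 and \<open>l\<close> on a projective line orthogonal to
    \<open>s\<close>, and \<open>?D \<noteq> 0\<close> makes it a hyperbolic line.\<close>
  define dd where "dd = ?D + (P1 * N2 - P2 * N1)"
  define r where "r = ((P1 + N1, P2 + N2), c + dd)"
  define t where "t = ((P1 + l * N1, P2 + l * N2), c + l * dd)"
  have sr: "heis_adj s r" unfolding s r_def heis_adj_def area_def dd_def f by (simp add: algebra_simps)
  have stt: "heis_adj s t" unfolding s t_def heis_adj_def area_def dd_def f by (simp add: algebra_simps)
  have pr: "\<not> heis_adj p r" using D N unfolding p r_def heis_adj_def area_def dd_def by (auto simp: algebra_simps)
  have pt: "\<not> heis_adj p t"
  proof
    assume "heis_adj p t"
    then have "l * ?D = 0" using N l unfolding p t_def heis_adj_def area_def dd_def by (auto simp: algebra_simps)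
    then show False using D l by simp
  qed
  have rt: "\<not> heis_adj r t"
  proof
    assume "heis_adj r t"
    then have "(l - 1) * ?D = 0" using N l unfolding r_def t_def heis_adj_def area_def dd_def by (auto simp: algebra_simps)
    then show False using D l by simp
  qed
  \<comment> \<open>The affine points of the polar of that hyperbolic line: they lie over the
    parallel to \<open>N\<close> through the base point of \<open>s\<close>, at the height that
    makes them collinear with \<open>p\<close>.\<close>
  define g where "g u = ((S1 + u * N1, S2 + u * N2), c + P1 * (S2 + u * N2) - P2 * (S1 + u * N1))" for u
  have "inj g" using N unfolding g_def inj_def by auto
  then have "card (range g) = CARD('a)" by (simp add: card_image)
  moreover have "range g \<subseteq> {n. heis_adj n p \<and> heis_adj n r \<and> heis_adj n t}"
    unfolding g_def p r_def t_def heis_adj_def area_def dd_def by (auto simp: algebra_simps)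
  then have "card (range g) \<le> card {n. heis_adj n p \<and> heis_adj n r \<and> heis_adj n t}"
    by (intro card_mono) auto
  ultimately show ?thesis using that[OF sr stt pr pt rt] q by auto
qed

text \<open>The bound on centres mentions only \<open>heis_adj\<close> and a cardinality, so the
  condition that singles out the pairs on vertical lines is carried along by
  \<open>g\<close>.\<close>

lemma heis_adj_automorphism_base:
  fixes g :: "('a::{field,finite} \<times> 'a) \<times> 'a \<Rightarrow> ('a \<times> 'a) \<times> 'a"
  assumes q: "CARD('a) \<ge> 5" and bij: "bij g" and g: "\<And>p r. heis_adj (g p) (g r) \<longleftrightarrow> heis_adj p r"
  shows "fst (g p) = fst (g s) \<longleftrightarrow> fst p = fst s"
proof -
  have img: "g ` {n. heis_adj n p \<and> heis_adj n r \<and> heis_adj n t} = {n. heis_adj n (g p) \<and> heis_adj n (g r) \<and> heis_adj n (g t)}" for p r t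
  proof -
    have "\<exists>m. n = g m" for n using bij by (metis bij_pointE)
    then show ?thesis by (fastforce simp: g set_eq_iff image_iff simp del: split_paired_All split_paired_Ex)
  qed
  have cd: "card {n. heis_adj n (g p) \<and> heis_adj n (g r) \<and> heis_adj n (g t)} = card {n. heis_adj n p \<and> heis_adj n r \<and> heis_adj n t}" for p r t
    unfolding img[symmetric] by (rule card_image[OF inj_on_subset[OF bij_is_inj[OF bij] subset_UNIV]])
  define C where "C p s r t \<longleftrightarrow> (heis_adj s r \<and> heis_adj s t \<and> \<not> heis_adj p r \<and> \<not> heis_adj p t \<and> \<not> heis_adj r t \<longrightarrow>
      card {n. heis_adj n p \<and> heis_adj n r \<and> heis_adj n t} \<le> 4)" for p s r t :: "('a \<times> 'a) \<times> 'a"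
  have gC: "C (g p) (g s) (g r) (g t) \<longleftrightarrow> C p s r t" for p s r t
    unfolding C_def g cd ..
  have eq: "fst p = fst s \<longleftrightarrow> heis_adj p s \<and> (\<forall>r t. C p s r t)" for p s
  proof (intro iffI conjI allI)
    show "heis_adj p s" if "fst p = fst s" using that by (simp add: heis_adj_def)
    show "C p s r t" if "fst p = fst s" for r t
      using vertical_few_centres[OF that] unfolding C_def by blast
    show "fst p = fst s" if "heis_adj p s \<and> (\<forall>r t. C p s r t)"
    proof (rule ccontr)
      assume nv: "fst p \<noteq> fst s"
      have "heis_adj p s" using that by simp
      then obtain r t where "heis_adj s r" "heis_adj s t" "\<not> heis_adj p r" "\<not> heis_adj p t" "\<not> heis_adj r t"
        "card {n. heis_adj n p \<and> heis_adj n r \<and> heis_adj n t} > 4"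
        using nonvertical_many_centres[OF q _ nv] by blast
      then have "\<not> C p s r t" unfolding C_def by simp
      then show False using that by blast
    qed
  qed
  have "(\<forall>r t. C (g p) (g s) r t) \<longleftrightarrow> (\<forall>r t. C (g p) (g s) (g r) (g t))"
    using bij_is_surj[OF bij] by (metis surjD)
  then show ?thesis unfolding eq g gC by blast
qed

text \<open>The differences of height around a triangle add up to 0, while the three determinants
  add up to the area of the base triangle. So distinct base points are collinear exactly if points
  over them can be chosen pairwise collinear, and the image of such a choice is again of this
  kind.\<close>

lemma heis_adj_automorphism_collin:
  fixes g :: "('a::{field,finite} \<times> 'a) \<times> 'a \<Rightarrow> ('a \<times> 'a) \<times> 'a"
  assumes q: "CARD('a) \<ge> 5" and bij: "bij g" and g: "\<And>p r. heis_adj (g p) (g r) \<longleftrightarrow> heis_adj p r"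
    and c: "collin P R T"
  shows "collin (fst (g (P, 0))) (fst (g (R, 0))) (fst (g (T, 0)))"
proof (cases "P = R \<or> P = T \<or> R = T")
  case True
  then show ?thesis unfolding collin_def area_def by auto
next
  case False
  note base = heis_adj_automorphism_base[OF q bij g]
  define p r t where "p = (P, 0::'a)" and "r = (R, area P R)" and "t = (T, area P T)"
  have "heis_adj p r" "heis_adj p t" "heis_adj r t"
    using c unfolding p_def r_def t_def heis_adj_def collin_def area_def
    by (auto simp: algebra_simps)
  then have "heis_adj (g p) (g r)" "heis_adj (g p) (g t)" "heis_adj (g r) (g t)" using g by auto
  moreover have "fst (g p) \<noteq> fst (g r)" "fst (g p) \<noteq> fst (g t)" "fst (g r) \<noteq> fst (g t)"
    using base False unfolding p_def r_def t_def by auto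
  ultimately have "snd (g r) - snd (g p) = area (fst (g p)) (fst (g r))"
     "snd (g t) - snd (g p) = area (fst (g p)) (fst (g t))"
     "snd (g t) - snd (g r) = area (fst (g r)) (fst (g t))" unfolding heis_adj_def by auto
  then have "collin (fst (g p)) (fst (g r)) (fst (g t))"
    unfolding collin_def area_def fst_diff snd_diff by algebra
  moreover have "fst (g p) = fst (g (P,0))" "fst (g r) = fst (g (R,0))" "fst (g t) = fst (g (T,0))"
    using base unfolding p_def r_def t_def by auto
  ultimately show ?thesis by simp
qed

text \<open>The two ends of a nonvertical line undergo the same change of height, because the
  determinant by which their heights differ is fixed by the base points. Such lines connect all
  points.\<close>

lemma heis_adj_automorphism_over_identity:
  fixes g :: "('a::field \<times> 'a) \<times> 'a \<Rightarrow> ('a \<times> 'a) \<times> 'a"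
  assumes g: "\<And>p r. heis_adj p r \<Longrightarrow> heis_adj (g p) (g r)" and base: "\<And>p. fst (g p) = fst p"
  obtains d where "\<And>p. g p = (fst p, snd p + d)"
proof -
  have step: "snd (g (Q, c + area P Q)) = snd (g (P, c)) + area P Q" for P Q c
  proof (cases "P = Q")
    case True
    then show ?thesis by (simp add: area_def)
  next
    case False
    have "heis_adj (g (P, c)) (g (Q, c + area P Q))" by (rule g) (auto simp: heis_adj_def)
    then show ?thesis using False base unfolding heis_adj_def by (auto simp: algebra_simps)
  qed
  have z: "snd (g (P, c)) = snd (g ((0,0), c))" for P c
    using step[where P="(0,0)" and Q=P and c=c] by (simp add: area_def)
  \<comment> \<open>The determinant of \<open>(1,0)\<close> and \<open>(0,c)\<close> is
    \<open>c\<close>, so one line leads from height 0 to height \<open>c\<close>; by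
    \<open>z\<close> the change of height does not depend on the base point.\<close>
  have "snd (g (P, c)) = c + snd (g ((0,0),0))" for P c
    using step[where P="(1,0)" and Q="(0,c)" and c=0] z[of P c] z[of "(0,c)" c] z[of "(1,0)" 0]
    by (simp add: area_def algebra_simps)
  then have "g p = (fst p, snd p + snd (g ((0,0),0)))" for p
    using base[of p] by (metis prod.collapse)
  then show ?thesis by (rule that)
qed

section \<open>Collineations of the affine plane\<close>

text \<open>Parallel lines are lines that do not meet, and since collinearity is also reflected, the
  images of parallel lines cannot meet either. This makes \<open>h\<close> act coordinatewise;
  incidence with suitable lines then gives the laws of a field automorphism.\<close>

lemma collineation_fixing_frame:
  fixes h :: "'a::field \<times> 'a \<Rightarrow> 'a \<times> 'a"
  assumes bij: "bij h" and c: "\<And>P R T. collin (h P) (h R) (h T) \<longleftrightarrow> collin P R T"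
    and h0: "h (0,0) = (0,0)" and h1: "h (1,0) = (1,0)" and h2: "h (0,1) = (0,1)"
  obtains s where "bij s" "\<And>a b. s (a + b) = s a + s b" "\<And>a b. s (a * b) = s a * s b"
    "\<And>a b. h (a,b) = (s a, s b)"
proof -
  note cd = collin_def area_def
  define s where "s a = fst (h (a,0))" for a
  define t where "t b = snd (h (0,b))" for b
  have ha: "h (a,0) = (s a, 0)" for a
    using c[of "(0,0)" "(1,0)" "(a,0)"] by (auto simp: s_def h0 h1 cd prod_eq_iff)
  have hb: "h (0,b) = (0, t b)" for b
    using c[of "(0,0)" "(0,1)" "(0,b)"] by (auto simp: t_def h0 h2 cd prod_eq_iff)
  have s0: "s 0 = 0" "s 1 = 1" "t 0 = 0" "t 1 = 1" using h0 h1 h2 by (auto simp: s_def t_def)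
  have surj0: "\<exists>y. h (0,y) = (0,z)" for z
  proof -
    obtain w where w: "h w = (0,z)" using bij by (metis bij_pointE)
    then have "fst w = 0" using c[of "(0,0)" "(0,1)" w] by (auto simp: h0 h2 cd)
    then show ?thesis using w by (metis prod.collapse)
  qed
  have surj1: "\<exists>y. h (y,0) = (z,0)" for z
  proof -
    obtain w where w: "h w = (z,0)" using bij by (metis bij_pointE)
    then have "snd w = 0" using c[of "(0,0)" "(1,0)" w] by (auto simp: h0 h1 cd)
    then show ?thesis using w by (metis prod.collapse)
  qed
  have f1: "fst (h (a,b)) = s a" for a b
  proof (rule ccontr)
    assume n: "fst (h (a,b)) \<noteq> s a"
    obtain A B where AB: "h (a,b) = (A,B)" by (rule prod.exhaust)
    \<comment> \<open>the line through the images of \<open>(a,0)\<close> and \<open>(a,b)\<close> would meet the second axis\<close>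
    obtain y where y: "h (0,y) = (0, - s a * B / (A - s a))" using surj0 by blast
    have "collin (h (a,0)) (h (a,b)) (h (0,y))"
      using n unfolding AB y ha cd by (simp add: field_simps)
    then have "a = 0 \<or> b = 0" unfolding c by (auto simp: cd)
    then show False using n s0 by (auto simp: ha hb)
  qed
  have f2: "snd (h (a,b)) = t b" for a b
  proof (rule ccontr)
    assume n: "snd (h (a,b)) \<noteq> t b"
    obtain A B where AB: "h (a,b) = (A,B)" by (rule prod.exhaust)
    \<comment> \<open>\<open>(Y, 0)\<close> is where the line through the images of
      \<open>(0,b)\<close> and \<open>(a,b)\<close> would cross the first axis.\<close>
    define Y where "Y = - (t b * A) / (B - t b)"
    have Y: "Y * (B - t b) = - (t b * A)" using n AB unfolding Y_def by simp
    obtain y where y: "h (y,0) = (Y, 0)" using surj1 by blast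
    have "collin (h (0,b)) (h (a,b)) (h (y,0))"
      using Y unfolding AB y hb cd by (simp add: algebra_simps)
    then have "a = 0 \<or> b = 0" unfolding c by (auto simp: cd)
    then show False using n s0 by (auto simp: ha hb)
  qed
  have hst: "h (a,b) = (s a, t b)" for a b using f1 f2 by (simp add: prod_eq_iff)
  \<comment> \<open>The diagonal identifies the two axis maps; after that, the line of slope
    \<open>a\<close> through the origin makes \<open>s\<close> multiplicative.\<close>
  have ts: "t a = s a" for a
    using c[of "(0,0)" "(1,1)" "(a,a)"] by (simp add: hst s0 cd)
  have mult: "s (a * b) = s a * s b" for a b
    using c[of "(0,0)" "(1,a)" "(b,a*b)"] by (simp add: hst s0 cd ts)
  have ssurj: "\<exists>w. s w = y" for y using surj1[of y] ha by auto
  have add: "s (a + b) = s a + s b" for a b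
  proof (rule ccontr)
    assume n: "s (a + b) \<noteq> s a + s b"
    \<comment> \<open>For nonzero \<open>a\<close> and \<open>b\<close> the line through
      \<open>(0,b)\<close> and \<open>(a,a+b)\<close> is parallel to the diagonal. If additivity
      failed, its image would meet the diagonal in \<open>(s w, s w)\<close>.\<close>
    obtain w where w: "s w = s a * s b / (s a + s b - s (a + b))" using ssurj by blast
    have "s w * (s a + s b - s (a + b)) = s a * s b" unfolding w using n by simp
    then have "collin (h (0,b)) (h (a,a+b)) (h (w,w))"
      unfolding hst ts cd by (simp add: s0 algebra_simps)
    then have "a = 0 \<or> b = 0" unfolding c by (auto simp: cd algebra_simps)
    then show False using n s0 by auto
  qed
  have "inj s" using bij ha by (metis bij_betw_imp_inj_on injI inj_eq prod.inject)
  then have "bij s" using ssurj by (metis bijI surjI surj_def)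
  then show ?thesis using that add mult hst ts by auto
qed

text \<open>Composing with the affine map that takes the image of the standard frame back to the
  frame reduces this to \<open>collineation_fixing_frame\<close>.\<close>

lemma collineation_semiaffine:
  fixes k :: "'a::field \<times> 'a \<Rightarrow> 'a \<times> 'a"
  assumes bij: "bij k" and c: "\<And>P R T. collin (k P) (k R) (k T) \<longleftrightarrow> collin P R T"
  obtains s u v t where "bij s" "\<And>a b. s (a + b) = s a + s b" "\<And>a b. s (a * b) = s a * s b"
    "area u v \<noteq> 0"
    "\<And>a b. k (a,b) = (fst u * s a + fst v * s b + fst t, snd u * s a + snd v * s b + snd t)"
proof -
  define t u v where "t = k (0,0)" and "u = k (1,0) - t" and "v = k (0,1) - t"
  have D: "area u v \<noteq> 0"
    using c[of "(0,0)" "(1,0)" "(0,1)"] unfolding collin_def u_def v_def t_def by (simp add: area_def)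
  \<comment> \<open>Cramer's rule: \<open>h P\<close> consists of the coordinates of
    \<open>k P - t\<close> in the basis \<open>u\<close>, \<open>v\<close>.\<close>
  define h where "h P = (area (k P - t) v / area u v, area u (k P - t) / area u v)" for P
  have kh: "k P = (fst u * fst (h P) + fst v * snd (h P) + fst t, snd u * fst (h P) + snd v * snd (h P) + snd t)" for P
  proof -
    define z where "z = k P - t"
    have "area z v * fst u + area u z * fst v = area u v * fst z" "area z v * snd u + area u z * snd v = area u v * snd z"
      by (auto simp: area_def algebra_simps)
    then have "fst z = fst u * fst (h P) + fst v * snd (h P)" "snd z = snd u * fst (h P) + snd v * snd (h P)"
      using D unfolding h_def z_def[symmetric] by (auto simp: field_simps)
    then show ?thesis unfolding z_def by (auto simp: prod_eq_iff algebra_simps)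
  qed
  have ch: "area (k R - k P) (k T - k P) = area u v * area (h R - h P) (h T - h P)" for P R T
    unfolding kh[of R] kh[of P] kh[of T] by (simp add: area_def algebra_simps)
  have hc: "collin (h P) (h R) (h T) \<longleftrightarrow> collin P R T" for P R T
    unfolding c[of P R T, symmetric] unfolding collin_def ch using D by simp
  have "bij h"
  proof (rule bijI)
    show "inj h"
      using kh bij by (metis bij_betw_imp_inj_on injI inj_eq)
    show "surj h"
    proof (rule surjI)
      fix y :: "'a \<times> 'a"
      let ?w = "(fst u * fst y + fst v * snd y + fst t, snd u * fst y + snd v * snd y + snd t)"
      have w: "k (inv_into UNIV k ?w) = ?w" using bij by (simp add: bij_is_surj surj_f_inv_f)
      have "h (inv_into UNIV k ?w) = (area (?w - t) v / area u v, area u (?w - t) / area u v)" unfolding h_def w ..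
      also have "area (?w - t) v = area u v * fst y" by (simp add: area_def algebra_simps)
      also have "area u (?w - t) = area u v * snd y" by (simp add: area_def algebra_simps)
      finally show "h (inv_into UNIV k ?w) = y" using D by simp
    qed
  qed
  moreover have "h (0,0) = (0,0)" by (simp add: h_def t_def area_def)
  moreover have "h (1,0) = (1,0)" using D unfolding h_def u_def[symmetric] by (simp add: area_def)
  moreover have "h (0,1) = (0,1)" using D unfolding h_def v_def[symmetric] by (simp add: area_def)
  ultimately obtain s where s: "bij s" "\<And>a b. s (a + b) = s a + s b" "\<And>a b. s (a * b) = s a * s b"
    "\<And>a b. h (a,b) = (s a, s b)"
    using collineation_fixing_frame[OF _ hc] by blast
  show ?thesis
  proof (rule that[OF s(1-3) D])
    show "k (a,b) = (fst u * s a + fst v * s b + fst t, snd u * s a + snd v * s b + snd t)" for a b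
      using kh[of "(a,b)"] s(4) by simp
  qed
qed

text \<open>An injection of the finite set of collinear triples into itself is onto, which leaves no
  collinear triple as the image of a noncollinear one.\<close>

lemma collineation_finite_iff:
  fixes k :: "'a::{field,finite} \<times> 'a \<Rightarrow> 'a \<times> 'a"
  assumes "bij k" and c: "\<And>P R T. collin P R T \<Longrightarrow> collin (k P) (k R) (k T)"
  shows "collin (k P) (k R) (k T) \<longleftrightarrow> collin P R T"
proof
  assume r: "collin (k P) (k R) (k T)"
  define C where "C = {(P :: 'a \<times> 'a, R, T). collin P R T}"
  define K where "K = (\<lambda>(P, R, T). (k P, k R, k T))"
  have k: "k P = k R \<longleftrightarrow> P = R" for P R using bij_is_inj[OF assms(1)] by (rule inj_eq)
  have "inj_on K C" unfolding K_def inj_on_def by (auto simp: k)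
  moreover have "K ` C \<subseteq> C" unfolding K_def C_def using c by auto
  ultimately have "K ` C = C" by (intro endo_inj_surj) auto
  moreover have "(k P, k R, k T) \<in> C" using r unfolding C_def by simp
  ultimately have "(k P, k R, k T) \<in> K ` C" by simp
  then show "collin P R T" unfolding K_def C_def by (auto simp: k)
qed (rule c)

lemma heis_adj_automorphism_induces:
  fixes h :: "('a::{field,finite} \<times> 'a) \<times> 'a \<Rightarrow> ('a \<times> 'a) \<times> 'a"
  assumes q: "CARD('a) \<ge> 5" and bij: "bij h" and h: "\<And>p r. heis_adj (h p) (h r) \<longleftrightarrow> heis_adj p r"
  obtains k where "bij k" "\<And>P R T. collin (k P) (k R) (k T) \<longleftrightarrow> collin P R T" "\<And>p. fst (h p) = k (fst p)"
proof -
  define k where "k P = fst (h (P, 0))" for P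
  have base: "fst (h p) = fst (h r) \<longleftrightarrow> fst p = fst r" for p r
    by (rule heis_adj_automorphism_base[OF q bij h])
  have fk: "fst (h p) = k (fst p)" for p unfolding k_def base by simp
  have "inj k" unfolding inj_def k_def base by simp
  then have bk: "bij k" by (simp add: bij_def finite_UNIV_inj_surj)
  have "collin (k P) (k R) (k T)" if "collin P R T" for P R T
    unfolding k_def by (rule heis_adj_automorphism_collin[OF q bij h that])
  then have "collin (k P) (k R) (k T) \<longleftrightarrow> collin P R T" for P R T
    by (rule collineation_finite_iff[OF bk])
  then show ?thesis using that bk fk by blast
qed

section \<open>Automorphisms and sharply transitive subgroups\<close>

lemma group_aut_group: "group (aut_group G)"
proof -
  let ?B = "BijGroup (points G)"
  interpret group ?B by (rule group_BijGroup)
  have cB: "carrier ?B = Bij (points G)" by (simp add: BijGroup_def)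
  have "subgroup (automorphisms G) ?B"
  proof (rule subgroupI)
    show "automorphisms G \<subseteq> carrier ?B" by (auto simp: automorphisms_def BijGroup_def)
    have "\<one>\<^bsub>?B\<^esub> \<in> automorphisms G"
      using one_closed unfolding automorphisms_def
      by (auto simp: BijGroup_def intro!: exI[of _ id])
    then show "automorphisms G \<noteq> {}" by auto
  next
    fix a assume a: "a \<in> automorphisms G"
    then obtain f where f: "bij_betw f (lines G) (lines G)"
      "\<And>p l. p \<in> points G \<Longrightarrow> l \<in> lines G \<Longrightarrow> inc G p l \<longleftrightarrow> inc G (a p) (f l)"
      and aB: "a \<in> Bij (points G)" unfolding automorphisms_def by auto
    have inv: "inv\<^bsub>?B\<^esub> a = (\<lambda>x\<in>points G. inv_into (points G) a x)" using aB by (rule inv_BijGroup)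
    have ab: "bij_betw a (points G) (points G)" using aB by (auto simp: Bij_def)
    have "inc G p l \<longleftrightarrow> inc G (inv_into (points G) a p) (inv_into (lines G) f l)"
      if "p \<in> points G" "l \<in> lines G" for p l
    proof -
      have "inv_into (points G) a p \<in> points G" "inv_into (lines G) f l \<in> lines G"
        using that ab f(1) by (auto simp: bij_betw_def intro: inv_into_into)
      then have "inc G (inv_into (points G) a p) (inv_into (lines G) f l) \<longleftrightarrow>
          inc G (a (inv_into (points G) a p)) (f (inv_into (lines G) f l))" by (rule f(2))
      then show ?thesis
        by (simp only: bij_betw_inv_into_right[OF ab that(1)] bij_betw_inv_into_right[OF f(1) that(2)])
    qed
    then have "\<exists>\<phi>. bij_betw \<phi> (lines G) (lines G) \<and>
     (\<forall>p \<in> points G. \<forall>l \<in> lines G. inc G p l \<longleftrightarrow> inc G ((inv\<^bsub>?B\<^esub> a) p) (\<phi> l))"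
      using bij_betw_inv_into[OF f(1)] unfolding inv by (intro exI[of _ "inv_into (lines G) f"]) simp
    moreover have "inv\<^bsub>?B\<^esub> a \<in> carrier ?B" using aB cB by blast
    ultimately show "inv\<^bsub>?B\<^esub> a \<in> automorphisms G" unfolding automorphisms_def cB by blast
  next
    fix a b assume ab: "a \<in> automorphisms G" "b \<in> automorphisms G"
    obtain f where f: "bij_betw f (lines G) (lines G)"
      "\<And>p l. p \<in> points G \<Longrightarrow> l \<in> lines G \<Longrightarrow> inc G p l \<longleftrightarrow> inc G (a p) (f l)"
      using ab unfolding automorphisms_def by auto
    obtain g where g: "bij_betw g (lines G) (lines G)"
      "\<And>p l. p \<in> points G \<Longrightarrow> l \<in> lines G \<Longrightarrow> inc G p l \<longleftrightarrow> inc G (b p) (g l)"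
      using ab unfolding automorphisms_def by auto
    have aB: "a \<in> Bij (points G)" "b \<in> Bij (points G)" using ab unfolding automorphisms_def by auto
    have m: "a \<otimes>\<^bsub>?B\<^esub> b = compose (points G) a b" using aB by (simp add: BijGroup_def)
    have "b p \<in> points G" if "p \<in> points G" for p
      using aB(2) that by (auto simp: Bij_def bij_betw_def)
    moreover have "g l \<in> lines G" if "l \<in> lines G" for l
      using g(1) that by (auto simp: bij_betw_def)
    ultimately have "inc G p l \<longleftrightarrow> inc G (compose (points G) a b p) ((f \<circ> g) l)"
      if "p \<in> points G" "l \<in> lines G" for p l
      unfolding g(2)[OF that] using f(2)[of "b p" "g l"] that by (simp add: compose_eq)
    then have "\<exists>\<phi>. bij_betw \<phi> (lines G) (lines G) \<and>
     (\<forall>p \<in> points G. \<forall>l \<in> lines G. inc G p l \<longleftrightarrow> inc G (compose (points G) a b p) (\<phi> l))"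
      using bij_betw_trans[OF g(1) f(1)] by blast
    then show "a \<otimes>\<^bsub>?B\<^esub> b \<in> automorphisms G"
      using compose_Bij[OF aB] unfolding m automorphisms_def by simp
  qed
  then show ?thesis unfolding aut_group_def by (rule subgroup_imp_group)
qed

lemma aut_group_simps:
  "carrier (aut_group G) = automorphisms G"
  "a \<in> automorphisms G \<Longrightarrow> b \<in> automorphisms G \<Longrightarrow> a \<otimes>\<^bsub>aut_group G\<^esub> b = compose (points G) a b"
  "\<one>\<^bsub>aut_group G\<^esub> = (\<lambda>p\<in>points G. p)"
  by (auto simp: aut_group_def BijGroup_def automorphisms_def)

lemma automorphism_bij_betw: "a \<in> automorphisms G \<Longrightarrow> bij_betw a (points G) (points G)"
  by (auto simp: automorphisms_def Bij_def)

lemma automorphism_undefined: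
  "a \<in> automorphisms G \<Longrightarrow> p \<notin> points G \<Longrightarrow> a p = undefined"
  by (auto simp: automorphisms_def Bij_def extensional_def)

lemma automorphism_closed:
  "a \<in> automorphisms G \<Longrightarrow> p \<in> points G \<Longrightarrow> a p \<in> points G"
  using automorphism_bij_betw by (auto simp: bij_betw_def)

lemma automorphism_inj_iff:
  "a \<in> automorphisms G \<Longrightarrow> p \<in> points G \<Longrightarrow> r \<in> points G \<Longrightarrow> a p = a r \<longleftrightarrow> p = r"
  using automorphism_bij_betw[of a G] by (auto simp: bij_betw_def inj_on_eq_iff)

text \<open>Stated for a set of points, so that it serves both for collinearity of two points and
  for three points of the plane on a line.\<close>

lemma automorphism_common_line:
  assumes "a \<in> automorphisms G" and "A \<subseteq> points G"
  shows "(\<exists>l \<in> lines G. \<forall>p \<in> A. inc G p l) \<longleftrightarrow> (\<exists>l \<in> lines G. \<forall>p \<in> A. inc G (a p) l)"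
proof -
  obtain f where f: "bij_betw f (lines G) (lines G)"
      "\<And>p l. p \<in> points G \<Longrightarrow> l \<in> lines G \<Longrightarrow> inc G p l \<longleftrightarrow> inc G (a p) (f l)"
      using assms unfolding automorphisms_def by auto
  have "(\<exists>l \<in> lines G. \<forall>p \<in> A. inc G (a p) l) \<longleftrightarrow> (\<exists>l \<in> f ` lines G. \<forall>p \<in> A. inc G (a p) l)"
    using f(1) by (simp add: bij_betw_def)
  also have "\<dots> \<longleftrightarrow> (\<exists>l \<in> lines G. \<forall>p \<in> A. inc G p l)"
    using f(2) assms(2) by (auto simp: subset_iff)
  finally show ?thesis ..
qed

lemma automorphism_collinear_in:
  assumes "a \<in> automorphisms G" "p \<in> points G" "r \<in> points G"
  shows "collinear_in G (a p) (a r) \<longleftrightarrow> collinear_in G p r"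
  using automorphism_common_line[OF assms(1), of "{p,r}"] assms(2,3)
  unfolding collinear_in_def by simp

lemma automorphism_perp:
  assumes a: "a \<in> automorphisms G" and A: "A \<subseteq> points G"
  shows "a ` perp G A = perp G (a ` A)"
proof -
  have "points G = a ` points G" using automorphism_bij_betw[OF a] by (simp add: bij_betw_def)
  then have "perp G (a ` A) = {y \<in> a ` points G. \<forall>b \<in> A. collinear_in G y (a b)}"
    unfolding perp_def by auto
  also have "\<dots> = a ` {y \<in> points G. \<forall>b \<in> A. collinear_in G y b}"
    using automorphism_collinear_in[OF a] A by (auto simp: subset_iff)
  finally show ?thesis unfolding perp_def ..
qed

lemma perp_subset: "perp G A \<subseteq> points G"
  by (auto simp: perp_def)

lemma finite_automorphismI:
  assumes "finite (points G)" "finite (lines G)"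
    and "a \<in> extensional (points G)" "inj_on a (points G)" "a ` points G \<subseteq> points G"
    and "inj_on f (lines G)" "f ` lines G \<subseteq> lines G"
    and "\<And>p l. p \<in> points G \<Longrightarrow> l \<in> lines G \<Longrightarrow> inc G p l \<longleftrightarrow> inc G (a p) (f l)"
  shows "a \<in> automorphisms G"
proof -
  have "bij_betw a (points G) (points G)" "bij_betw f (lines G) (lines G)"
    using assms(4-7) endo_inj_surj[OF assms(1) assms(5)] endo_inj_surj[OF assms(2) assms(7)]
    unfolding bij_betw_def by blast+
  then show ?thesis using assms unfolding automorphisms_def Bij_def by blast
qed

lemma sharply_transitive_preimage_bij:
  fixes A :: "'g monoid" and AP :: "('p \<Rightarrow> 'p) monoid" and AL :: "('m \<Rightarrow> 'm) monoid"
  assumes grp: "group A" "group AP" "group AL"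
    and rho: "\<rho> \<in> hom A AP" and rhob: "bij_betw \<rho> (carrier A) (carrier AP)"
    and pi: "\<pi> \<in> hom A AL" and pis: "\<pi> ` carrier A = carrier AL"
    and P: "\<And>\<theta> p. \<theta> \<in> carrier A \<Longrightarrow> p \<in> P \<Longrightarrow> \<rho> \<theta> p \<in> P"
    and rhoc: "\<And>\<theta> \<eta> p. \<theta> \<in> carrier A \<Longrightarrow> \<eta> \<in> carrier A \<Longrightarrow> p \<in> P \<Longrightarrow> \<rho> (\<theta> \<otimes>\<^bsub>A\<^esub> \<eta>) p = \<rho> \<theta> (\<rho> \<eta> p)"
    and rho1: "\<And>p. p \<in> P \<Longrightarrow> \<rho> \<one>\<^bsub>A\<^esub> p = p"
    and equi: "\<And>\<theta> p. \<theta> \<in> carrier A \<Longrightarrow> p \<in> P \<Longrightarrow> \<beta> (\<rho> \<theta> p) = \<pi> \<theta> (\<beta> p)"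
    and S: "S = {\<theta> \<in> carrier A. \<pi> \<theta> = \<one>\<^bsub>AL\<^esub>}"
    and L: "\<beta> ` P = L"
    and free: "\<And>\<theta> p. \<theta> \<in> S \<Longrightarrow> p \<in> P \<Longrightarrow> \<rho> \<theta> p = p \<Longrightarrow> \<theta> = \<one>\<^bsub>A\<^esub>"
    and trans: "\<And>p r. p \<in> P \<Longrightarrow> r \<in> P \<Longrightarrow> \<beta> p = \<beta> r \<Longrightarrow> \<exists>\<theta> \<in> S. \<rho> \<theta> p = r"
  shows "bij_betw (\<lambda>K. \<rho> ` {\<theta> \<in> carrier A. \<pi> \<theta> \<in> K})
    {K. subgroup K AL \<and> sharply_transitive_on K L}
    {G. subgroup G AP \<and> sharply_transitive_on G P \<and> \<rho> ` S \<subseteq> G}"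
proof -
  interpret A: group A by fact
  interpret AP: group AP by fact
  interpret AL: group AL by fact
  interpret r: group_hom A AP \<rho> by unfold_locales fact
  interpret q: group_hom A AL \<pi> by unfold_locales fact
  let ?pre = "\<lambda>K. {\<theta> \<in> carrier A. \<pi> \<theta> \<in> K}"
  \<comment> \<open>Otherwise the simplifier would push \<open>\<rho>\<close> through products,
    inverses and the unit, and the pointwise rules \<open>rhoc\<close> and \<open>rho1\<close> would
    no longer match.\<close>
  note r.hom_mult [simp del] r.hom_inv [simp del] r.hom_one [simp del]
  have inj: "inj_on \<rho> (carrier A)" using rhob by (simp add: bij_betw_def)
  have pre: "subgroup (?pre K) A" if K: "subgroup K AL" for K
  proof (rule A.subgroupI)
    show "?pre K \<noteq> {}" using subgroup.one_closed[OF K] by (auto intro!: exI[of _ "\<one>\<^bsub>A\<^esub>"])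
  qed (auto simp: subgroup.m_inv_closed[OF K] subgroup.m_closed[OF K])
  have cancel: "\<rho> (inv\<^bsub>A\<^esub> \<theta>) (\<rho> \<theta> p) = p" if "\<theta> \<in> carrier A" "p \<in> P" for \<theta> p
    using rhoc[of "inv\<^bsub>A\<^esub> \<theta>" \<theta> p] that by (simp add: rho1)
  have fibre: "\<theta> = \<eta>" if "\<theta> \<in> carrier A" "\<eta> \<in> carrier A" "\<pi> \<theta> = \<pi> \<eta>" "p \<in> P" "\<rho> \<theta> p = \<rho> \<eta> p" for \<theta> \<eta> p
  proof -
    have "inv\<^bsub>A\<^esub> \<eta> \<otimes>\<^bsub>A\<^esub> \<theta> \<in> S" using that by (simp add: S)
    moreover have "\<rho> (inv\<^bsub>A\<^esub> \<eta> \<otimes>\<^bsub>A\<^esub> \<theta>) p = p" using that by (simp add: rhoc cancel)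
    ultimately have "inv\<^bsub>A\<^esub> \<eta> \<otimes>\<^bsub>A\<^esub> \<theta> = \<one>\<^bsub>A\<^esub>" using free that(4) by blast
    then show ?thesis using that by (metis A.inv_closed A.inv_equality A.inv_inv)
  qed
  \<comment> \<open>An element that takes the fibre of \<open>p\<close> to that of \<open>s\<close>
    may miss \<open>s\<close> itself; a kernel element corrects this without changing the image
    under \<open>\<pi>\<close>. The factor \<open>\<kappa>\<close> is recorded so that the
    correction can be seen to stay in any subgroup containing \<open>S\<close>.\<close>
  have adjust: "\<exists>\<eta> \<in> carrier A. \<pi> \<eta> = \<pi> \<theta> \<and> \<rho> \<eta> p = s \<and> (\<exists>\<kappa> \<in> S. \<eta> = \<kappa> \<otimes>\<^bsub>A\<^esub> \<theta>)"
    if "\<theta> \<in> carrier A" "p \<in> P" "s \<in> P" "\<pi> \<theta> (\<beta> p) = \<beta> s" for \<theta> p s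
  proof -
    have "\<exists>\<kappa> \<in> S. \<rho> \<kappa> (\<rho> \<theta> p) = s"
      using trans[OF P[OF that(1,2)] that(3)] equi[OF that(1,2)] that(4) by simp
    then obtain \<kappa> where k: "\<kappa> \<in> S" "\<rho> \<kappa> (\<rho> \<theta> p) = s" by blast
    then show ?thesis using that
      by (intro bexI[of _ "\<kappa> \<otimes>\<^bsub>A\<^esub> \<theta>"]) (auto simp: S rhoc)
  qed
  show ?thesis
  proof (rule bij_betwI')
    fix K K' assume K: "K \<in> {K. subgroup K AL \<and> sharply_transitive_on K L}"
      and K': "K' \<in> {K. subgroup K AL \<and> sharply_transitive_on K L}"
    have im: "K = \<pi> ` ?pre K" if "subgroup K AL" for K
      using subgroup.subset[OF that] unfolding pis[symmetric] by blast
    have "K = K'" if "\<rho> ` ?pre K = \<rho> ` ?pre K'"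
    proof -
      have "?pre K = ?pre K'"
        using inj_on_image_eq_iff[OF inj, of "?pre K" "?pre K'"] that by blast
      then show ?thesis using im[of K] im[of K'] K K' by simp
    qed
    then show "(\<rho> ` ?pre K = \<rho> ` ?pre K') \<longleftrightarrow> K = K'" by blast
  next
    fix K assume "K \<in> {K. subgroup K AL \<and> sharply_transitive_on K L}"
    then have K: "subgroup K AL" and Kt: "sharply_transitive_on K L" by auto
    have "subgroup (\<rho> ` ?pre K) AP" using pre[OF K] by (rule r.subgroup_img_is_subgroup)
    moreover have "sharply_transitive_on (\<rho> ` ?pre K) P" unfolding sharply_transitive_on_def
    proof (intro ballI)
      fix p s assume ps: "p \<in> P" "s \<in> P"
      then have "\<exists>!k. k \<in> K \<and> k (\<beta> p) = \<beta> s" using Kt L unfolding sharply_transitive_on_def by blast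
      then obtain k where k: "k \<in> K" "k (\<beta> p) = \<beta> s"
        and ku: "\<And>k'. k' \<in> K \<Longrightarrow> k' (\<beta> p) = \<beta> s \<Longrightarrow> k' = k" by blast
      obtain \<theta> where th: "\<theta> \<in> carrier A" "\<pi> \<theta> = k"
        using k(1) subgroup.subset[OF K] unfolding pis[symmetric] by blast
      obtain \<eta> where et: "\<eta> \<in> carrier A" "\<pi> \<eta> = k" "\<rho> \<eta> p = s" using adjust[OF th(1) ps] k th by auto
      show "\<exists>!g. g \<in> \<rho> ` ?pre K \<and> g p = s"
      proof (rule ex1I[of _ "\<rho> \<eta>"])
        show "\<rho> \<eta> \<in> \<rho> ` ?pre K \<and> \<rho> \<eta> p = s" using et k by auto
      next
        fix g assume "g \<in> \<rho> ` ?pre K \<and> g p = s"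
        then obtain \<theta> where t: "\<theta> \<in> carrier A" "\<pi> \<theta> \<in> K" "g = \<rho> \<theta>" "\<rho> \<theta> p = s" by auto
        then have "\<pi> \<theta> = k" using ku equi[OF t(1) ps(1)] by simp
        then show "g = \<rho> \<eta>" using fibre[OF t(1) et(1) _ ps(1)] et t by simp
      qed
    qed
    moreover have "\<rho> ` S \<subseteq> \<rho> ` ?pre K"
      using subgroup.one_closed[OF K] by (intro image_mono) (auto simp: S)
    ultimately show "\<rho> ` ?pre K \<in> {G. subgroup G AP \<and> sharply_transitive_on G P \<and> \<rho> ` S \<subseteq> G}"
      by simp
  next
    fix G assume "G \<in> {G. subgroup G AP \<and> sharply_transitive_on G P \<and> \<rho> ` S \<subseteq> G}"
    then have G: "subgroup G AP" and Gt: "sharply_transitive_on G P" and GS: "\<rho> ` S \<subseteq> G" by auto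
    define H where "H = {\<theta> \<in> carrier A. \<rho> \<theta> \<in> G}"
    have H: "subgroup H A"
    proof (rule A.subgroupI)
      show "H \<noteq> {}" using subgroup.one_closed[OF G] r.hom_one unfolding H_def by (auto intro!: exI[of _ "\<one>\<^bsub>A\<^esub>"])
    qed (auto simp: H_def r.hom_mult r.hom_inv subgroup.m_inv_closed[OF G] subgroup.m_closed[OF G])
    have "\<rho> ` H = \<rho> ` carrier A \<inter> G" unfolding H_def by blast
    then have rH: "\<rho> ` H = G"
      using subgroup.subset[OF G] bij_betw_imp_surj_on[OF rhob] by (simp add: Int_absorb1)
    have SH: "S \<subseteq> H" using GS unfolding H_def S by blast
    \<comment> \<open>Two elements with the same image under \<open>\<pi>\<close> differ by an
      element of \<open>S\<close>, and \<open>S \<subseteq> H\<close>.\<close>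
    have preH: "?pre (\<pi> ` H) = H"
    proof (intro equalityI subsetI)
      fix \<theta> assume "\<theta> \<in> ?pre (\<pi> ` H)"
      then obtain \<eta> where e: "\<theta> \<in> carrier A" "\<eta> \<in> H" "\<pi> \<theta> = \<pi> \<eta>" by auto
      then have ec: "\<eta> \<in> carrier A" unfolding H_def by simp
      have "\<theta> \<otimes>\<^bsub>A\<^esub> inv\<^bsub>A\<^esub> \<eta> \<in> S" unfolding S using e(1,3) ec by simp
      then have "\<theta> \<otimes>\<^bsub>A\<^esub> inv\<^bsub>A\<^esub> \<eta> \<in> H" using SH by blast
      then have "\<theta> \<otimes>\<^bsub>A\<^esub> inv\<^bsub>A\<^esub> \<eta> \<otimes>\<^bsub>A\<^esub> \<eta> \<in> H" using e(2) subgroup.m_closed[OF H] by blast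
      then show "\<theta> \<in> H" using e ec by (simp add: A.m_assoc)
    qed (auto simp: H_def)
    have "sharply_transitive_on (\<pi> ` H) L" unfolding sharply_transitive_on_def
    proof (intro ballI)
      fix l m assume "l \<in> L" "m \<in> L"
      then obtain p s where ps: "p \<in> P" "s \<in> P" and lm: "l = \<beta> p" "m = \<beta> s" using L by auto
      then have "\<exists>!g. g \<in> G \<and> g p = s" using Gt unfolding sharply_transitive_on_def by blast
      then obtain g where g: "g \<in> G" "g p = s"
        and gu: "\<And>g'. g' \<in> G \<Longrightarrow> g' p = s \<Longrightarrow> g' = g" by blast
      from g(1) obtain \<theta> where th: "\<theta> \<in> H" "g = \<rho> \<theta>" unfolding rH[symmetric] by blast
      then have thc: "\<theta> \<in> carrier A" unfolding H_def by simp
      show "\<exists>!k. k \<in> \<pi> ` H \<and> k l = m"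
      proof (rule ex1I[of _ "\<pi> \<theta>"])
        show "\<pi> \<theta> \<in> \<pi> ` H \<and> \<pi> \<theta> l = m" using th thc equi[of \<theta> p] ps lm g by auto
      next
        fix k assume "k \<in> \<pi> ` H \<and> k l = m"
        then obtain \<eta> where e: "\<eta> \<in> H" "k = \<pi> \<eta>" "\<pi> \<eta> (\<beta> p) = \<beta> s" using lm by auto
        then have ec: "\<eta> \<in> carrier A" unfolding H_def by simp
        \<comment> \<open>\<open>\<eta>\<close> need not map \<open>p\<close> to \<open>s\<close>.
          The corrected \<open>z\<close> does and is still in \<open>H\<close>, so sharp
          transitivity of \<open>G\<close> identifies it with \<open>\<theta>\<close>.\<close>
        obtain z \<kappa> where z: "\<pi> z = \<pi> \<eta>" "\<rho> z p = s" "\<kappa> \<in> S" "z = \<kappa> \<otimes>\<^bsub>A\<^esub> \<eta>"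
          using adjust[OF ec ps e(3)] by blast
        then have "z \<in> H" using SH e subgroup.m_closed[OF H] by blast
        then have zc: "z \<in> carrier A" "\<rho> z \<in> G" unfolding H_def by auto
        then have "\<rho> z = \<rho> \<theta>" using gu z th by auto
        then have "z = \<theta>" using inj zc thc by (auto simp: inj_on_def)
        then show "k = \<pi> \<theta>" using z e by simp
      qed
    qed
    moreover have "subgroup (\<pi> ` H) AL" using H by (rule q.subgroup_img_is_subgroup)
    ultimately show "\<exists>K \<in> {K. subgroup K AL \<and> sharply_transitive_on K L}. G = \<rho> ` ?pre K"
      using preH rH by (intro bexI[of _ "\<pi> ` H"]) auto
  qed
qed

section \<open>Coordinates in the symplectic quadrangle\<close>

abbreviation pspan :: "'a::field ^ 'n \<Rightarrow> ('a ^ 'n) set" where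
  "pspan v \<equiv> vec.span {v}"

lemma pspan_eq: "pspan v = range (\<lambda>c. c *s v)"
  by (rule vec.span_singleton)

lemma pspan_self: "v \<in> pspan v"
  by (simp add: vec.span_base)

lemma pspan_subset_iff:
  "vec.subspace U \<Longrightarrow> pspan v \<subseteq> U \<longleftrightarrow> v \<in> U"
  using pspan_self[of v] vec.span_minimal[of "{v}" U] by auto

lemma pspan_eqD:
  "u \<noteq> 0 \<Longrightarrow> pspan u = pspan v \<Longrightarrow> \<exists>c. c \<noteq> 0 \<and> u = c *s v"
proof -
  assume u: "u \<noteq> 0" and "pspan u = pspan v"
  then have "u \<in> pspan v" using pspan_self by blast
  then obtain c where "u = c *s v" unfolding pspan_eq by blast
  then show ?thesis using u by (cases "c = 0") auto
qed

lemma pspan_scale: "c \<noteq> 0 \<Longrightarrow> pspan (c *s v) = pspan (v :: 'a::field ^ 'n)"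
proof
  assume c: "c \<noteq> 0"
  have "c *s v \<in> pspan v" unfolding pspan_eq by blast
  then show "pspan (c *s v) \<subseteq> pspan v" by (simp add: vec.span_minimal)
  have "v = inverse c *s (c *s v)" using c by simp
  then have "v \<in> pspan (c *s v)" unfolding pspan_eq by blast
  then show "pspan v \<subseteq> pspan (c *s v)" by (simp add: vec.span_minimal)
qed

lemma pg_points_eq: "pg_points = {pspan v | v. v \<noteq> (0 :: 'a::field ^ 'n)}"
proof (intro equalityI subsetI)
  fix p :: "('a ^ 'n) set" assume "p \<in> pg_points"
  then have p: "vec.subspace p" "vec.dim p = 1" by (auto simp: pg_points_def)
  obtain S where S: "S \<subseteq> p" "vec.independent S" "p \<subseteq> vec.span S" "card S = vec.dim p"
    by (rule vec.basis_exists)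
  then obtain v where v: "S = {v}" using p(2) by (metis card_1_singletonE)
  have "p = pspan v" using S v p(1) vec.span_minimal[of S p] by auto
  moreover have "v \<noteq> 0" using S(2) v by auto
  ultimately show "p \<in> {pspan v | v. v \<noteq> 0}" by auto
next
  fix p :: "('a ^ 'n) set" assume "p \<in> {pspan v | v. v \<noteq> 0}"
  then obtain v where v: "p = pspan v" "v \<noteq> 0" by auto
  then show "p \<in> pg_points"
    using vec.dim_span_eq_card_independent[of "{v}"] by (simp add: pg_points_def)
qed

lemma pspan_point: "v \<noteq> 0 \<Longrightarrow> pspan v \<in> pg_points"
  by (auto simp: pg_points_eq)

lemma pg_pointE:
  assumes "p \<in> pg_points" obtains v where "v \<noteq> 0" "p = pspan v"
  using assms by (auto simp: pg_points_eq)

lemma span_pair: "vec.span {u, v} = {a *s u + b *s v | a b. True}" for u v :: "'a::field ^ 'n"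
proof (intro equalityI subsetI)
  fix w assume "w \<in> vec.span {u, v}"
  then obtain k where "w - k *s u \<in> pspan v" using vec.span_breakdown[of u "{u,v}" w]
    by (metis insertI1 vec.span_breakdown_eq)
  then obtain b where "w - k *s u = b *s v" unfolding pspan_eq by blast
  then have "w = k *s u + b *s v" by (simp add: algebra_simps)
  then show "w \<in> {a *s u + b *s v | a b. True}" by blast
next
  fix w assume "w \<in> {a *s u + b *s v | a b. True}"
  then obtain a b where "w = a *s u + b *s v" by blast
  then show "w \<in> vec.span {u, v}"
    by (simp add: vec.span_add vec.span_scale vec.span_base)
qed

lemma dim_2_basis:
  assumes U: "vec.subspace (U :: ('a::field ^ 'n) set)" "vec.dim U = 2"
  obtains u v where "u \<noteq> 0" "v \<notin> pspan u" "U = vec.span {u, v}"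
proof -
  obtain S where S: "S \<subseteq> U" "vec.independent S" "U \<subseteq> vec.span S" "card S = vec.dim U"
    by (rule vec.basis_exists)
  then obtain v u where uv: "S = {v, u}" "u \<noteq> v" using U(2) by (metis card_2_iff)
  have "U = vec.span {u, v}" using S uv U(1) vec.span_minimal[of S U] by (auto simp: insert_commute)
  moreover have "v \<notin> pspan u" "u \<noteq> 0" using S(2) uv by (auto simp: vec.independent_insert)
  ultimately show ?thesis using that by blast
qed

lemma dim_span_pair:
  assumes "u \<noteq> 0" "v \<notin> pspan u"
  shows "vec.dim (vec.span {u, v :: 'a::field ^ 'n}) = 2"
proof -
  have ne: "u \<noteq> v" using assms pspan_self by blast
  have "vec.independent {v, u}" using assms ne by (simp add: vec.independent_insert)
  then show ?thesis using vec.dim_span_eq_card_independent[of "{v,u}"] ne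
    by (simp add: insert_commute)
qed

section \<open>Symplectic forms and symplectic bases\<close>

lemma symplectic_form_bilinear:
  assumes "symplectic_form B"
  shows "B (v + w) u = B v u + B w u" "B u (v + w) = B u v + B u w"
    "B (c *s v) u = c * B v u" "B u (c *s v) = c * B u v"
proof -
  have "Vector_Spaces.linear (*s) (*) (B u)" "Vector_Spaces.linear (*s) (*) (\<lambda>w. B w u)"
    using assms unfolding symplectic_form_def by blast+
  note linear = this[unfolded Vector_Spaces.linear_def module_hom_iff]
  show "B (v + w) u = B v u + B w u" "B u (v + w) = B u v + B u w"
    "B (c *s v) u = c * B v u" "B u (c *s v) = c * B u v"
    using linear by blast+
qed

lemma symplectic_form_self: "symplectic_form B \<Longrightarrow> B u u = 0"
  unfolding symplectic_form_def by blast

lemma symplectic_form_skew: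
  assumes B: "symplectic_form B"
  shows "B v u = - B u v"
proof -
  have "B (u + v) (u + v) = (B u u + B v v) + (B v u + B u v)"
    by (simp only: symplectic_form_bilinear[OF B] add_ac)
  then have "B v u + B u v = 0" unfolding symplectic_form_self[OF B] by simp
  then show ?thesis by (rule eq_neg_iff_add_eq_0[THEN iffD2])
qed

text \<open>A symplectic basis whose first vector spans the centre. Pairing with the basis vectors
  returns the coordinates of a combination, so independence follows from the six values, and
  spanning then follows from finiteness.\<close>

locale symplectic_frame =
  fixes B :: "'a::{field,finite} ^ 4 \<Rightarrow> 'a ^ 4 \<Rightarrow> 'a" and e0 e1 e2 e3 :: "'a ^ 4"
  assumes symp: "symplectic_form B"
    and frame: "B e0 e3 = 1" "B e1 e2 = 1" "B e0 e1 = 0" "B e0 e2 = 0" "B e1 e3 = 0" "B e2 e3 = 0"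
begin

lemmas B_simps = symplectic_form_bilinear[OF symp] symplectic_form_self[OF symp]

lemmas B_self = symplectic_form_self[OF symp]

lemma B_nondegenerate: "(\<And>v. B u v = 0) \<Longrightarrow> u = 0"
  using symp unfolding symplectic_form_def by blast

lemmas B_skew = symplectic_form_skew[OF symp]

lemma B_commute: "B v u = 0 \<longleftrightarrow> B u v = 0"
  using B_skew[of v u] by simp

lemma frame': "B e3 e0 = -1" "B e2 e1 = -1" "B e1 e0 = 0" "B e2 e0 = 0" "B e3 e1 = 0" "B e3 e2 = 0"
  by (simp_all only: frame B_skew[of e3 e0] B_skew[of e2 e1] B_skew[of e1 e0] B_skew[of e2 e0]
      B_skew[of e3 e1] B_skew[of e3 e2] minus_zero)

definition coord :: "'a \<Rightarrow> 'a \<Rightarrow> 'a \<Rightarrow> 'a \<Rightarrow> 'a ^ 4" where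
  "coord z0 z1 z2 z3 = z0 *s e0 + z1 *s e1 + z2 *s e2 + z3 *s e3"

lemma B_coord: "B (coord z0 z1 z2 z3) (coord w0 w1 w2 w3) = z0 * w3 - z3 * w0 + z1 * w2 - z2 * w1"
  unfolding coord_def by (simp add: B_simps frame frame' algebra_simps)

lemma B_coord_frame:
  "B (coord z0 z1 z2 z3) e3 = z0" "B (coord z0 z1 z2 z3) e2 = z1"
  "B e1 (coord z0 z1 z2 z3) = z2" "B e0 (coord z0 z1 z2 z3) = z3"
  unfolding coord_def by (simp_all add: B_simps frame frame')

lemma coord_inject:
  "coord z0 z1 z2 z3 = coord w0 w1 w2 w3 \<longleftrightarrow> z0 = w0 \<and> z1 = w1 \<and> z2 = w2 \<and> z3 = w3"
proof
  assume eq: "coord z0 z1 z2 z3 = coord w0 w1 w2 w3"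
  show "z0 = w0 \<and> z1 = w1 \<and> z2 = w2 \<and> z3 = w3"
    using arg_cong[OF eq, of "\<lambda>v. B v e3"] arg_cong[OF eq, of "\<lambda>v. B v e2"]
      arg_cong[OF eq, of "B e1"] arg_cong[OF eq, of "B e0"] unfolding B_coord_frame by blast
qed simp

text \<open>Feeding the standard coordinates into \<open>coord\<close> gives an injective self-map
  of a finite space.\<close>

lemma coord_exhaust: obtains z0 z1 z2 z3 where "v = coord z0 z1 z2 z3"
proof -
  define f :: "'a ^ 4 \<Rightarrow> 'a ^ 4" where "f w = coord (w$1) (w$2) (w$3) (w$4)" for w
  have "inj f" unfolding f_def inj_def coord_inject by (simp add: vec_eq_iff forall_4)
  then have "surj f" by (simp add: finite_UNIV_inj_surj)
  then obtain w where "v = f w" by blast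
  then show ?thesis using that f_def by blast
qed

lemma coord_scale: "c *s coord z0 z1 z2 z3 = coord (c * z0) (c * z1) (c * z2) (c * z3)"
  unfolding coord_def by (simp add: vec.scale_right_distrib)

lemma coord_add: "coord z0 z1 z2 z3 + coord w0 w1 w2 w3 = coord (z0 + w0) (z1 + w1) (z2 + w2) (z3 + w3)"
  unfolding coord_def by (simp add: vec.scale_left_distrib)

lemma coord_0: "coord z0 z1 z2 z3 = 0 \<longleftrightarrow> z0 = 0 \<and> z1 = 0 \<and> z2 = 0 \<and> z3 = 0"
  using coord_inject[of z0 z1 z2 z3 0 0 0 0] by (simp add: coord_def)

lemma e0_coord: "e0 = coord 1 0 0 0" by (simp add: coord_def)

abbreviation "W \<equiv> symplectic_quadrangle B"
abbreviation "x \<equiv> pspan e0"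

lemma W_simps: "points W = pg_points" "inc W = (\<in>)"
  by (simp_all add: symplectic_quadrangle_def)

lemma isotropic_span:
  assumes "B u v = 0" "a \<in> vec.span {u,v}" "b \<in> vec.span {u,v}"
  shows "B a b = 0"
  using assms B_commute[of v u] unfolding span_pair by (auto simp: B_simps)

lemma lines_W:
  "lines W = {{p \<in> pg_points. p \<subseteq> vec.span {u, v}} | u v. u \<noteq> 0 \<and> v \<notin> pspan u \<and> B u v = 0}"
  (is "_ = ?R")
proof (intro equalityI subsetI)
  fix l assume "l \<in> lines W"
  then obtain U where U: "l = {p \<in> pg_points. p \<subseteq> U}" "vec.subspace U" "vec.dim U = 2"
    "\<forall>u \<in> U. \<forall>v \<in> U. B u v = 0" unfolding symplectic_quadrangle_def by auto
  obtain u v where uv: "u \<noteq> 0" "v \<notin> pspan u" "U = vec.span {u, v}" using U(2,3) by (rule dim_2_basis)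
  have "u \<in> U" "v \<in> U" unfolding uv(3) by (simp_all add: vec.span_base)
  then have "B u v = 0" using U(4) by blast
  then show "l \<in> ?R" using U(1) uv by blast
next
  fix l assume "l \<in> ?R"
  then obtain u v where uv: "u \<noteq> 0" "v \<notin> pspan u" "B u v = 0"
    and l: "l = {p \<in> pg_points. p \<subseteq> vec.span {u, v}}" by blast
  have "\<forall>a \<in> vec.span {u,v}. \<forall>b \<in> vec.span {u,v}. B a b = 0" using isotropic_span[OF uv(3)] by blast
  then show "l \<in> lines W" using dim_span_pair[OF uv(1,2)] vec.subspace_span[of "{u,v}"] l
    unfolding symplectic_quadrangle_def by auto
qed

text \<open>Provides a line through a single point, so that each point is collinear with itself. If
  all vectors orthogonal to \<open>u\<close> were multiples of \<open>u\<close>, subtracting a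
  multiple of some \<open>a\<close> not orthogonal to \<open>u\<close> would place the whole 4-space
  in the span of \<open>u\<close> and \<open>a\<close>.\<close>

lemma isotropic_partner: assumes "u \<noteq> 0" obtains w where "w \<notin> pspan u" "B u w = 0"
proof (rule ccontr)
  assume "\<not> thesis"
  then have n: "\<And>w. B u w = 0 \<Longrightarrow> w \<in> pspan u" using that by blast
  obtain a where a: "B u a \<noteq> 0" using B_nondegenerate assms by blast
  have "v \<in> vec.span {u, a}" for v
  proof -
    have "B u (v + (- (B u v / B u a)) *s a) = 0" using a by (simp only: B_simps) simp
    then obtain c where "v + (- (B u v / B u a)) *s a = c *s u" using n unfolding pspan_eq by blast
    then have "v = c *s u + (B u v / B u a) *s a" by (simp add: algebra_simps)
    then show ?thesis unfolding span_pair by blast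
  qed
  then have "vec.span {u, a} = (UNIV :: ('a ^ 4) set)" by blast
  then have "vec.dim (UNIV :: ('a ^ 4) set) \<le> card {u, a}"
    by (intro vec.dim_le_card) auto
  also have "\<dots> \<le> 2" by (simp add: card_insert_if)
  finally show False by (simp only: vec_dim_card) simp
qed

lemma collinear_W:
  assumes "u \<noteq> 0" "v \<noteq> 0"
  shows "collinear_in W (pspan u) (pspan v) \<longleftrightarrow> B u v = 0"
proof
  assume "collinear_in W (pspan u) (pspan v)"
  then obtain a b where ab: "B a b = 0" and "pspan u \<subseteq> vec.span {a,b}" "pspan v \<subseteq> vec.span {a,b}"
    unfolding collinear_in_def lines_W W_simps by blast
  then show "B u v = 0" using isotropic_span[OF ab] pspan_self by blast
next
  assume uv: "B u v = 0"
  have *: "collinear_in W (pspan u) (pspan v)" if "w \<notin> pspan u" "B u w = 0" "v \<in> vec.span {u, w}" for w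
  proof -
    have "{p \<in> pg_points. p \<subseteq> vec.span {u, w}} \<in> lines W" unfolding lines_W using that assms by blast
    moreover have "pspan u \<subseteq> vec.span {u, w}" "pspan v \<subseteq> vec.span {u, w}"
      using that(3) by (simp_all add: pspan_subset_iff vec.span_base)
    moreover have "pspan u \<in> {p \<in> pg_points. p \<subseteq> vec.span {u, w}}" "pspan v \<in> {p \<in> pg_points. p \<subseteq> vec.span {u, w}}"
      using calculation(2,3) pspan_point[OF assms(1)] pspan_point[OF assms(2)] by simp_all
    ultimately show ?thesis unfolding collinear_in_def W_simps by (intro bexI conjI)
  qed
  show "collinear_in W (pspan u) (pspan v)"
  proof (cases "v \<in> pspan u")
    case True
    obtain w where w: "w \<notin> pspan u" "B u w = 0" using isotropic_partner[OF assms(1)] by blast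
    have "v \<in> vec.span {u, w}" using True vec.span_mono[of "{u}" "{u,w}"] by blast
    then show ?thesis using * w by blast
  next
    case False
    then show ?thesis using * uv by (simp add: vec.span_base)
  qed
qed

lemma perp_W:
  assumes "0 \<notin> V" "v \<noteq> 0"
  shows "pspan v \<in> perp W (pspan ` V) \<longleftrightarrow> (\<forall>u \<in> V. B v u = 0)"
proof -
  have "collinear_in W (pspan v) (pspan u) \<longleftrightarrow> B v u = 0" if "u \<in> V" for u
  proof (rule collinear_W[OF assms(2)])
    show "u \<noteq> 0" using that assms(1) by metis
  qed
  then show ?thesis unfolding perp_def W_simps using pspan_point[OF assms(2)] by simp
qed

section \<open>The derived quadrangle and the affine plane in coordinates\<close>

abbreviation "PQ \<equiv> payne_derived W x"
abbreviation "PL \<equiv> plane_at W x"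

text \<open>Noncollinearity with \<open>x\<close> means a nonzero last coordinate, here scaled to 1.
  The height is the coefficient of \<open>e0\<close>, so changing it moves along the projective line
  through \<open>x\<close>.\<close>

definition affine_vec :: "('a \<times> 'a) \<times> 'a \<Rightarrow> 'a ^ 4" where
  "affine_vec p = coord (snd p) (fst (fst p)) (snd (fst p)) 1"

definition affine_pt :: "('a \<times> 'a) \<times> 'a \<Rightarrow> ('a ^ 4) set" where
  "affine_pt p = pspan (affine_vec p)"

text \<open>Height 0 is an arbitrary representative: by \<open>perp_x_pt_base_pt\<close> the set
  depends only on the base point.\<close>

definition base_pt :: "'a \<times> 'a \<Rightarrow> ('a ^ 4) set set" where
  "base_pt P = perp W {x, affine_pt (P, 0)}"

lemma affine_vec_nonzero: "affine_vec p \<noteq> 0"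
  unfolding affine_vec_def coord_0 by simp

lemma e0_nonzero: "e0 \<noteq> 0"
  using coord_0[of 1 0 0 0] unfolding e0_coord[symmetric] by simp

lemma affine_pt_point: "affine_pt p \<in> pg_points"
  unfolding affine_pt_def by (rule pspan_point[OF affine_vec_nonzero])

lemma x_point: "x \<in> pg_points"
  by (rule pspan_point[OF e0_nonzero])

lemma affine_pt_inject: "affine_pt p = affine_pt r \<longleftrightarrow> p = r"
proof
  assume "affine_pt p = affine_pt r"
  then obtain c where "affine_vec p = c *s affine_vec r" unfolding affine_pt_def using pspan_eqD[OF affine_vec_nonzero] by blast
  then show "p = r" unfolding affine_vec_def coord_scale coord_inject by (auto simp: prod_eq_iff)
qed simp

lemma B_e0: "B (coord z0 z1 z2 z3) e0 = - z3"
  using B_coord[of z0 z1 z2 z3 1 0 0 0] unfolding e0_coord[symmetric] by simp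

lemma perp_x_iff: "v \<noteq> 0 \<Longrightarrow> pspan v \<in> perp W {x} \<longleftrightarrow> B v e0 = 0"
  using perp_W[of "{e0}" v] e0_nonzero by simp

lemma x_perp: "x \<in> perp W {x}"
  unfolding perp_x_iff[OF e0_nonzero] by (rule B_self)

lemma affine_pt_not_perp: "affine_pt p \<notin> perp W {x}"
  unfolding affine_pt_def perp_x_iff[OF affine_vec_nonzero] unfolding affine_vec_def B_e0 by simp

lemma points_PQ: "points PQ = range affine_pt"
proof (intro equalityI subsetI)
  fix p assume "p \<in> points PQ"
  then have p: "p \<in> pg_points" "p \<notin> perp W {x}" by (auto simp: payne_derived_def W_simps)
  obtain v where v: "v \<noteq> 0" "p = pspan v" using p(1) by (rule pg_pointE)
  obtain z0 z1 z2 z3 where z: "v = coord z0 z1 z2 z3" by (rule coord_exhaust)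
  have z3: "z3 \<noteq> 0" using p(2) unfolding v(2) perp_x_iff[OF v(1)] unfolding z B_e0 by simp
  have "p = pspan (inverse z3 *s v)" using z3 v(2) by (simp add: pspan_scale)
  also have "\<dots> = affine_pt ((inverse z3 * z1, inverse z3 * z2), inverse z3 * z0)"
    unfolding z coord_scale affine_pt_def affine_vec_def using z3 by simp
  finally show "p \<in> range affine_pt" by blast
next
  fix p assume "p \<in> range affine_pt"
  then show "p \<in> points PQ" using affine_pt_point affine_pt_not_perp by (auto simp: payne_derived_def W_simps)
qed

text \<open>In the form the height of \<open>p\<close> is multiplied by \<open>z3\<close>, which
  orthogonality to \<open>e0\<close> makes 0.\<close>

lemma perp_x_pt_iff:
  assumes "coord z0 z1 z2 z3 \<noteq> 0"
  shows "pspan (coord z0 z1 z2 z3) \<in> perp W {x, affine_pt p} \<longleftrightarrow> z3 = 0 \<and> z0 = z2 * fst (fst p) - z1 * snd (fst p)"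
proof -
  have "pspan (coord z0 z1 z2 z3) \<in> perp W (pspan ` {e0, affine_vec p}) \<longleftrightarrow>
      B (coord z0 z1 z2 z3) e0 = 0 \<and> B (coord z0 z1 z2 z3) (affine_vec p) = 0"
    using e0_nonzero affine_vec_nonzero[of p] by (subst perp_W[OF _ assms]) auto
  moreover have "pspan ` {e0, affine_vec p} = {x, affine_pt p}" by (simp add: affine_pt_def)
  ultimately show ?thesis unfolding B_e0 unfolding affine_vec_def B_coord by (auto simp: algebra_simps)
qed

lemma perp_x_pt:
  "perp W {x, affine_pt p} = pspan ` {coord (v * fst (fst p) - u * snd (fst p)) u v 0 | u v. (u, v) \<noteq> (0, 0)}"
  (is "_ = pspan ` ?V")
proof (intro equalityI subsetI)
  fix y assume y: "y \<in> perp W {x, affine_pt p}"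
  then have "y \<in> pg_points" by (simp add: perp_def W_simps)
  then obtain w where w: "w \<noteq> 0" "y = pspan w" by (rule pg_pointE)
  obtain z0 z1 z2 z3 where z: "w = coord z0 z1 z2 z3" by (rule coord_exhaust)
  have "z3 = 0" "z0 = z2 * fst (fst p) - z1 * snd (fst p)"
    using y w(1) unfolding w(2) z using perp_x_pt_iff by blast+
  then show "y \<in> pspan ` ?V" using w(1) unfolding w(2) z coord_0 by auto
next
  fix y assume "y \<in> pspan ` ?V"
  then obtain u v where y: "y = pspan (coord (v * fst (fst p) - u * snd (fst p)) u v 0)" "(u, v) \<noteq> (0, 0)" by blast
  then have "coord (v * fst (fst p) - u * snd (fst p)) u v 0 \<noteq> 0" unfolding coord_0 by auto
  then show "y \<in> perp W {x, affine_pt p}" unfolding y(1) using perp_x_pt_iff by blast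
qed

lemma perp_x_pt_base_pt: "perp W {x, affine_pt p} = base_pt (fst p)"
  unfolding base_pt_def perp_x_pt by simp

lemma base_pt_iff:
  assumes "coord z0 z1 z2 z3 \<noteq> 0"
  shows "pspan (coord z0 z1 z2 z3) \<in> base_pt P \<longleftrightarrow> z3 = 0 \<and> z0 = z2 * fst P - z1 * snd P"
  unfolding base_pt_def perp_x_pt_iff[OF assms] by simp

lemma base_pt_inject: "base_pt P = base_pt R \<longleftrightarrow> P = R"
proof
  assume eq: "base_pt P = base_pt R"
  have 1: "coord (- snd P) 1 0 0 \<noteq> 0" "coord (fst P) 0 1 0 \<noteq> 0" unfolding coord_0 by auto
  have "pspan (coord (- snd P) 1 0 0) \<in> base_pt P" "pspan (coord (fst P) 0 1 0) \<in> base_pt P"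
    unfolding 1[THEN base_pt_iff] by simp_all
  then show "P = R" unfolding eq 1[THEN base_pt_iff] by (simp add: prod_eq_iff)
qed simp

lemma points_PL: "points PL = range base_pt"
proof -
  have "points PL = {perp W {x, z} | z. z \<in> points PQ}"
    by (simp add: plane_at_def payne_derived_def)
  also have "\<dots> = range (\<lambda>p. perp W {x, affine_pt p})" unfolding points_PQ by blast
  also have "\<dots> = range (\<lambda>p :: ('a \<times> 'a) \<times> 'a. base_pt (fst p))" unfolding perp_x_pt_base_pt by (rule refl)
  also have "\<dots> = range base_pt" by (auto intro: image_eqI[of _ _ "(_, 0)"])
  finally show ?thesis .
qed

lemma base_pt_perp: "base_pt P \<subseteq> perp W {x}"
  unfolding base_pt_def perp_def by auto

lemma x_notin_base_pt: "x \<notin> base_pt P"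
proof -
  have "coord 1 0 0 0 \<noteq> 0" unfolding coord_0 by simp
  then have "pspan (coord 1 0 0 0) \<notin> base_pt P" by (simp add: base_pt_iff)
  then show ?thesis unfolding e0_coord[symmetric] .
qed

lemma lines_PL: "lines PL = perp W {x} - {x}" and inc_PL: "inc PL m r \<longleftrightarrow> r \<in> m"
  by (simp_all add: plane_at_def)

lemma perp_x_cases:
  assumes "y \<in> perp W {x} - {x}"
  obtains u v w where "(u, v) \<noteq> (0, 0)" "y = pspan (coord w u v 0)"
proof -
  have "y \<in> pg_points" using assms by (simp add: perp_def W_simps)
  then obtain a where a: "a \<noteq> 0" "y = pspan a" by (rule pg_pointE)
  obtain z0 z1 z2 z3 where z: "a = coord z0 z1 z2 z3" by (rule coord_exhaust)
  have z3: "z3 = 0" using assms unfolding a(2) using perp_x_iff[OF a(1)] unfolding z B_e0 by simp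
  have "(z1, z2) \<noteq> (0, 0)"
  proof
    assume "(z1, z2) = (0, 0)"
    then have "a = z0 *s coord 1 0 0 0" "z0 \<noteq> 0" using a(1) z3 unfolding z coord_scale coord_0 by simp_all
    then have "a = z0 *s e0" "z0 \<noteq> 0" unfolding e0_coord[symmetric] by simp_all
    then show False using assms a(2) pspan_scale[of z0 e0] by simp
  qed
  then show ?thesis using that a(2) z z3 by blast
qed

text \<open>The point spanned by \<open>coord w u v 0\<close> plays the role of the affine line
  \<open>v * X - u * Y = w\<close> with direction \<open>(u, v)\<close>, so the lines of the plane
  at \<open>x\<close> are the usual affine lines.\<close>

lemma collin_iff_common_line:
  "collin P R T \<longleftrightarrow> (\<exists>l \<in> lines PL. \<forall>m \<in> base_pt ` {P, R, T}. inc PL m l)"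
proof
  assume c: "collin P R T"
  \<comment> \<open>The direction of a line through the three points; if they coincide any direction
    serves.\<close>
  obtain u v where uv: "(u, v) \<noteq> (0, 0)" "area (R - P) (u, v) = 0" "area (T - P) (u, v) = 0"
  proof (cases "R = P")
    case True
    show ?thesis
    proof (cases "T = P")
      case True
      show ?thesis by (rule that[of 1 0]) (auto simp: \<open>R = P\<close> True area_def)
    next
      case False
      show ?thesis by (rule that[of "fst (T - P)" "snd (T - P)"]) (use False in \<open>auto simp: \<open>R = P\<close> area_def prod_eq_iff\<close>)
    qed
  next
    case False
    show ?thesis by (rule that[of "fst (R - P)" "snd (R - P)"])
      (use False c in \<open>auto simp: collin_def area_def prod_eq_iff algebra_simps\<close>)
  qed
  let ?m = "coord (v * fst P - u * snd P) u v 0"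
  have m: "?m \<noteq> 0" using uv(1) unfolding coord_0 by auto
  have "pspan ?m \<in> base_pt P \<and> pspan ?m \<in> base_pt R \<and> pspan ?m \<in> base_pt T"
    unfolding base_pt_iff[OF m] using uv(2,3) unfolding area_def by (auto simp: algebra_simps)
  moreover have "pspan ?m \<in> perp W {x} - {x}"
    using calculation base_pt_perp[of P] x_notin_base_pt[of P] by (cases "pspan ?m = x") auto
  ultimately show "\<exists>l \<in> lines PL. \<forall>m \<in> base_pt ` {P, R, T}. inc PL m l"
    unfolding lines_PL inc_PL by blast
next
  assume "\<exists>l \<in> lines PL. \<forall>m \<in> base_pt ` {P, R, T}. inc PL m l"
  then obtain l where l: "l \<in> perp W {x} - {x}" and i: "l \<in> base_pt P" "l \<in> base_pt R" "l \<in> base_pt T"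
    unfolding lines_PL inc_PL by auto
  obtain u v w where uv: "(u, v) \<noteq> (0, 0)" and l': "l = pspan (coord w u v 0)" using l by (rule perp_x_cases)
  have m: "coord w u v 0 \<noteq> 0" using uv unfolding coord_0 by auto
  have e: "w = v * fst P - u * snd P" "w = v * fst R - u * snd R" "w = v * fst T - u * snd T"
    using i unfolding l' base_pt_iff[OF m] by simp_all
  have "u * area (R - P) (T - P) = 0" "v * area (R - P) (T - P) = 0"
    unfolding area_def fst_diff snd_diff using e by algebra+
  then show "collin P R T" using uv unfolding collin_def by auto
qed

text \<open>This turns the hyperbolic lines through \<open>x\<close> into the vertical lines.
  Orthogonality to the elements with \<open>(u, v)\<close> equal to \<open>(1, 0)\<close> and
  \<open>(0, 1)\<close> already compares both base coordinates.\<close>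

lemma hyperbolic_line_iff:
  "affine_pt r \<in> perp W (perp W {x, affine_pt p}) \<longleftrightarrow> fst r = fst p"
proof -
  let ?V = "{coord (v * fst (fst p) - u * snd (fst p)) u v 0 | u v. (u, v) \<noteq> (0, 0)}"
  have "0 \<notin> ?V"
  proof
    assume "0 \<in> ?V"
    then obtain u v where "0 = coord (v * fst (fst p) - u * snd (fst p)) u v 0" "(u, v) \<noteq> (0, 0)" by blast
    from this(1)[symmetric] this(2) show False unfolding coord_0 by simp
  qed
  then have "affine_pt r \<in> perp W (perp W {x, affine_pt p}) \<longleftrightarrow> (\<forall>w \<in> ?V. B (affine_vec r) w = 0)"
    unfolding perp_x_pt affine_pt_def[of r] by (rule perp_W[OF _ affine_vec_nonzero])
  also have "\<dots> \<longleftrightarrow> (\<forall>u v. (u, v) \<noteq> (0, 0) \<longrightarrow> B (affine_vec r) (coord (v * fst (fst p) - u * snd (fst p)) u v 0) = 0)"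
    by blast
  also have "\<dots> \<longleftrightarrow> (\<forall>u v. (u, v) \<noteq> (0, 0) \<longrightarrow> v * (fst (fst r) - fst (fst p)) = u * (snd (fst r) - snd (fst p)))"
    (is "_ \<longleftrightarrow> ?R")
    unfolding affine_vec_def B_coord by (simp add: algebra_simps)
  also have "\<dots> \<longleftrightarrow> fst r = fst p"
  proof
    assume ?R
    from this[rule_format, of 1 0] this[rule_format, of 0 1] show "fst r = fst p"
      by (simp add: prod_eq_iff)
  qed simp
  finally show ?thesis .
qed

lemma lines_PQ:
  "lines PQ = {l \<in> lines W. x \<notin> l} \<union> {perp W (perp W {x, affine_pt p}) - {x} | p. True}"
proof -
  have "lines PQ = {l \<in> lines W. x \<notin> l} \<union> {perp W (perp W {x, r}) - {x} | r. r \<in> points PQ}"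
    by (simp add: payne_derived_def)
  then show ?thesis unfolding points_PQ by blast
qed

lemma inc_PQ: "inc PQ p l \<longleftrightarrow> p \<in> l"
  by (simp add: payne_derived_def)

lemma affine_pt_not_x: "affine_pt p \<noteq> x"
  using affine_pt_not_perp x_perp by metis

text \<open>Lines of \<open>W\<close> missing \<open>x\<close> account for the determinant condition
  in \<open>heis_adj\<close>, hyperbolic lines for equality of base points.\<close>

lemma collinear_PQ: "collinear_in PQ (affine_pt p) (affine_pt r) \<longleftrightarrow> heis_adj p r"
proof
  assume "collinear_in PQ (affine_pt p) (affine_pt r)"
  then obtain l where l: "l \<in> lines PQ" "affine_pt p \<in> l" "affine_pt r \<in> l" unfolding collinear_in_def inc_PQ by blast
  show "heis_adj p r"
  proof (cases "l \<in> lines W")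
    case True
    then have "collinear_in W (affine_pt p) (affine_pt r)" unfolding collinear_in_def W_simps using l by blast
    then have "B (affine_vec p) (affine_vec r) = 0" unfolding affine_pt_def using collinear_W[OF affine_vec_nonzero affine_vec_nonzero] by blast
    then show ?thesis unfolding affine_vec_def B_coord heis_adj_def area_def by (simp add: algebra_simps)
  next
    case False
    then obtain s where "l = perp W (perp W {x, affine_pt s}) - {x}" using l(1) unfolding lines_PQ by blast
    then show ?thesis using l(2,3) hyperbolic_line_iff unfolding heis_adj_def by simp
  qed
next
  assume h: "heis_adj p r"
  show "collinear_in PQ (affine_pt p) (affine_pt r)"
  proof (cases "fst p = fst r")
    case True
    let ?l = "perp W (perp W {x, affine_pt p}) - {x}"
    have "?l \<in> lines PQ" unfolding lines_PQ by blast
    moreover have "affine_pt p \<in> ?l" "affine_pt r \<in> ?l" using hyperbolic_line_iff affine_pt_not_x True by simp_all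
    ultimately show ?thesis unfolding collinear_in_def inc_PQ by (intro bexI[of _ ?l] conjI)
  next
    case False
    let ?U = "vec.span {affine_vec p, affine_vec r}"
    let ?l = "{y \<in> pg_points. y \<subseteq> ?U}"
    have "B (affine_vec p) (affine_vec r) = 0" using h False unfolding affine_vec_def B_coord heis_adj_def area_def by (simp add: algebra_simps)
    moreover have "affine_vec r \<notin> pspan (affine_vec p)"
    proof
      assume "affine_vec r \<in> pspan (affine_vec p)"
      then obtain c where "affine_vec r = c *s affine_vec p" unfolding pspan_eq by blast
      then show False using False unfolding affine_vec_def coord_scale coord_inject by (simp add: prod_eq_iff)
    qed
    ultimately have "?l \<in> lines W" unfolding lines_W using affine_vec_nonzero by blast
    \<comment> \<open>If \<open>e0\<close> were in the span, the last coordinates would give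
      \<open>b = - a\<close> and the first ones \<open>a \<noteq> 0\<close>; then the middle
      coordinates would make the base points equal.\<close>
    moreover have "x \<notin> ?l"
    proof
      assume "x \<in> ?l"
      then have "e0 \<in> ?U" using pspan_self by blast
      then obtain a b where e: "e0 = a *s affine_vec p + b *s affine_vec r" unfolding span_pair by blast
      then have "coord 1 0 0 0 = a *s affine_vec p + b *s affine_vec r" unfolding e0_coord[symmetric] .
      then have "a + b = 0" "a * fst (fst p) + b * fst (fst r) = 0" "a * snd (fst p) + b * snd (fst r) = 0"
        "a * snd p + b * snd r = 1"
        unfolding affine_vec_def coord_scale coord_add coord_inject by simp_all
      note ab = this
      have b: "b = - a" using ab(1) by (simp add: eq_neg_iff_add_eq_0 add.commute)
      have "a * (fst (fst p) - fst (fst r)) = 0" "a * (snd (fst p) - snd (fst r)) = 0" "a \<noteq> 0"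
        using ab(2-4) unfolding b by (auto simp: right_diff_distrib)
      then show False using False by (simp add: prod_eq_iff)
    qed
    ultimately have "?l \<in> lines PQ" unfolding lines_PQ by blast
    moreover have "affine_pt p \<subseteq> ?U" "affine_pt r \<subseteq> ?U" unfolding affine_pt_def by (intro vec.span_mono; blast)+
    then have "affine_pt p \<in> ?l" "affine_pt r \<in> ?l" using affine_pt_point by blast+
    ultimately show ?thesis unfolding collinear_in_def inc_PQ by (intro bexI[of _ ?l] conjI)
  qed
qed

section \<open>Lifting collineations\<close>

text \<open>A semisimilarity preserves orthogonality and hence isotropic lines; nondegeneracy makes
  it injective, as \<open>T u = 0\<close> forces \<open>u\<close> to be orthogonal to
  everything.\<close>

lemma semilinear_automorphism:
  assumes s: "bij s" "\<And>a b. s (a + b) = s a + s b" "\<And>a b. s (a * b) = s a * s b"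
    and T: "\<And>u v. T (u + v) = T u + T v" "\<And>c v. T (c *s v) = s c *s T v"
    and BT: "\<And>u v. B (T u) (T v) = m * s (B u v)" and m: "m \<noteq> 0"
  shows "(\<lambda>p\<in>pg_points. T ` p) \<in> automorphisms W" and "T ` pspan v = pspan (T v)"
proof -
  have s0: "s 0 = 0" using s(2)[of 0 0] unfolding add_0_left add_cancel_right_right .
  have sc: "s c = 0 \<longleftrightarrow> c = 0" for c using bij_is_inj[OF s(1)] s0 by (metis inj_eq)
  have ss: "range s = UNIV" using s(1) by (rule bij_is_surj)
  have B0: "B 0 w = 0" for w using symplectic_form_bilinear(3)[OF symp, of 0 0 w] by simp
  have T0: "T u = 0 \<Longrightarrow> u = 0" for u
  proof (rule B_nondegenerate)
    fix w assume "T u = 0"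
    then show "B u w = 0" using BT[of u w] m by (simp add: B0 sc)
  qed
  have inj: "inj T"
  proof (rule injI)
    fix u v assume "T u = T v"
    moreover have "T u = T (u - v) + T v" using T(1)[of "u - v" v] by simp
    ultimately have "T (u - v) = 0" by simp
    then show "u = v" using T0[of "u - v"] by simp
  qed
  have Tps: "T ` pspan v = pspan (T v)" for v
  proof -
    have "T ` pspan v = (\<lambda>c. c *s T v) ` range s" unfolding pspan_eq by (simp add: image_image T(2))
    then show ?thesis unfolding ss pspan_eq .
  qed
  then show "T ` pspan v = pspan (T v)" .
  have Tspan: "T ` vec.span {u, v} = vec.span {T u, T v}" for u v
  proof -
    have "vec.span {u, v} = (\<lambda>(a, b). a *s u + b *s v) ` UNIV" for u v :: "'a ^ 4"
      unfolding span_pair by auto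
    then have "T ` vec.span {u, v} = (\<lambda>(a, b). a *s T u + b *s T v) ` (map_prod s s ` UNIV)"
      by (simp add: image_image T case_prod_beta)
    also have "map_prod s s ` UNIV = UNIV" using ss by (simp add: map_prod_surj)
    finally show ?thesis unfolding span_pair by auto
  qed
  have pg: "T ` p \<in> pg_points" if "p \<in> pg_points" for p
    using that
  proof (rule pg_pointE)
    fix v assume "v \<noteq> 0" "p = pspan v"
    then show "T ` p \<in> pg_points" using Tps pspan_point[of "T v"] T0 by auto
  qed
  show "(\<lambda>p\<in>pg_points. T ` p) \<in> automorphisms W"
  proof (rule finite_automorphismI[where f = "\<lambda>l. (\<lambda>p. T ` p) ` l"], unfold W_simps)
    show "inj_on (\<lambda>p\<in>pg_points. T ` p) pg_points"
      by (intro inj_onI) (simp add: inj_image_eq_iff[OF inj])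
    have ii: "inj (\<lambda>p. T ` p)" using inj by (simp add: inj_def inj_image_eq_iff)
    show "inj_on (\<lambda>l. (\<lambda>p. T ` p) ` l) (lines W)"
      by (intro inj_onI) (simp add: inj_image_eq_iff[OF ii])
    show "(\<lambda>l. (\<lambda>p. T ` p) ` l) ` lines W \<subseteq> lines W"
    proof (intro image_subsetI)
      fix l assume "l \<in> lines W"
      then obtain u v where uv: "u \<noteq> 0" "v \<notin> pspan u" "B u v = 0"
        and l: "l = {p \<in> pg_points. p \<subseteq> vec.span {u, v}}" unfolding lines_W by blast
      have "(\<lambda>p. T ` p) ` l = {p \<in> pg_points. p \<subseteq> vec.span {T u, T v}}"
      proof (intro equalityI subsetI)
        fix p assume "p \<in> (\<lambda>p. T ` p) ` l"
        then show "p \<in> {p \<in> pg_points. p \<subseteq> vec.span {T u, T v}}"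
          unfolding l Tspan[symmetric] using pg by auto
      next
        fix p assume p: "p \<in> {p \<in> pg_points. p \<subseteq> vec.span {T u, T v}}"
        then obtain w where w: "w \<noteq> 0" "p = pspan w" using pg_pointE by blast
        then have "w \<in> T ` vec.span {u, v}" using p pspan_self unfolding Tspan by blast
        then obtain z where z: "w = T z" "z \<in> vec.span {u, v}" by blast
        have "z \<noteq> 0"
        proof
          assume "z = 0"
          then have "w = 0" using z(1) T(2)[of 0 0] s0 by simp
          then show False using w by simp
        qed
        then have "pspan z \<in> l" unfolding l using pspan_point z(2) by (simp add: pspan_subset_iff)
        moreover have "p = T ` pspan z" using Tps w z by simp
        ultimately show "p \<in> (\<lambda>p. T ` p) ` l" by blast
      qed
      moreover have "T u \<noteq> 0" using T0 uv(1) by blast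
      moreover have "T v \<notin> pspan (T u)" unfolding Tps[symmetric] using uv(2) inj by (simp add: inj_image_mem_iff)
      moreover have "B (T u) (T v) = 0" by (simp add: BT uv(3) s0)
      ultimately show "(\<lambda>p. T ` p) ` l \<in> lines W" unfolding lines_W by blast
    qed
    show "p \<in> l \<longleftrightarrow> (\<lambda>p\<in>pg_points. T ` p) p \<in> (\<lambda>p. T ` p) ` l" if "p \<in> pg_points" for p l
      using that by (simp add: inj_image_mem_iff[OF ii])
  qed (use pg in auto)
qed

text \<open>
  On base points the map below is \<open>(a, b) \<mapsto> s a *s u + s b *s v + t\<close>; the first coordinate is chosen so
  that the form gets multiplied by \<open>area u v\<close>.
\<close>

lemma semiaffine_automorphism:
  assumes s: "bij s" "\<And>a b. s (a + b) = s a + s b" "\<And>a b. s (a * b) = s a * s b"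
    and D: "area u v \<noteq> 0"
  shows "\<exists>\<theta> \<in> automorphisms W. \<forall>z0 z1 z2 z3. coord z0 z1 z2 z3 \<noteq> 0 \<longrightarrow> \<theta> (pspan (coord z0 z1 z2 z3)) =
      pspan (coord (area u v * s z0 - area u t * s z1 - area v t * s z2 + d * s z3)
        (fst u * s z1 + fst v * s z2 + fst t * s z3) (snd u * s z1 + snd v * s z2 + snd t * s z3) (s z3))"
proof -
  define F where "F z0 z1 z2 z3 = coord (area u v * s z0 - area u t * s z1 - area v t * s z2 + d * s z3)
        (fst u * s z1 + fst v * s z2 + fst t * s z3) (snd u * s z1 + snd v * s z2 + snd t * s z3) (s z3)"
    for z0 z1 z2 z3
  \<comment> \<open>The four form values are the coordinates of \<open>w\<close>, by
    \<open>B_coord_frame\<close>.\<close>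
  define T where "T w = F (B w e3) (B w e2) (B e1 w) (B e0 w)" for w
  have T: "T (coord z0 z1 z2 z3) = F z0 z1 z2 z3" for z0 z1 z2 z3
    unfolding T_def B_coord_frame ..
  have sd: "s (a - b) = s a - s b" for a b using s(2)[of "a - b" b] by simp
  have 1: "T (a + b) = T a + T b" for a b
  proof -
    obtain z0 z1 z2 z3 w0 w1 w2 w3 where ab: "a = coord z0 z1 z2 z3" "b = coord w0 w1 w2 w3"
      using coord_exhaust[of a] coord_exhaust[of b] by metis
    show ?thesis unfolding ab coord_add T unfolding F_def coord_add coord_inject by (simp add: s(2) algebra_simps)
  qed
  have 2: "T (c *s a) = s c *s T a" for c a
  proof -
    obtain z0 z1 z2 z3 where a: "a = coord z0 z1 z2 z3" by (rule coord_exhaust)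
    show ?thesis unfolding a coord_scale T unfolding F_def coord_scale coord_inject by (simp add: s(3) algebra_simps)
  qed
  have 3: "B (T a) (T b) = area u v * s (B a b)" for a b
  proof -
    obtain z0 z1 z2 z3 w0 w1 w2 w3 where ab: "a = coord z0 z1 z2 z3" "b = coord w0 w1 w2 w3"
      using coord_exhaust[of a] coord_exhaust[of b] by metis
    show ?thesis unfolding ab B_coord T unfolding F_def B_coord sd s(2,3) area_def by (simp add: algebra_simps)
  qed
  note semi = semilinear_automorphism[OF s 1 2 3 D]
  show ?thesis
  proof (intro bexI[OF _ semi(1)] allI impI)
    fix z0 z1 z2 z3 assume "coord z0 z1 z2 z3 \<noteq> 0"
    then show "(\<lambda>p\<in>pg_points. T ` p) (pspan (coord z0 z1 z2 z3)) =
      pspan (coord (area u v * s z0 - area u t * s z1 - area v t * s z2 + d * s z3)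
        (fst u * s z1 + fst v * s z2 + fst t * s z3) (snd u * s z1 + snd v * s z2 + snd t * s z3) (s z3))"
      using pspan_point[of "coord z0 z1 z2 z3"] semi(2)[of "coord z0 z1 z2 z3"] unfolding T unfolding F_def by simp
  qed
qed

lemma collineation_lift:
  assumes "bij k" and "\<And>P R T. collin (k P) (k R) (k T) \<longleftrightarrow> collin P R T"
  obtains \<theta> where "\<theta> \<in> aut_stabilizer W x" "\<And>p. \<exists>c. \<theta> (affine_pt p) = affine_pt (k (fst p), c)"
proof -
  obtain s u v t where s: "bij s" "\<And>a b. s (a + b) = s a + s b" "\<And>a b. s (a * b) = s a * s b"
    and D: "area u v \<noteq> 0"
    and k: "\<And>a b. k (a,b) = (fst u * s a + fst v * s b + fst t, snd u * s a + snd v * s b + snd t)"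
    using collineation_semiaffine[OF assms] by metis
  obtain \<theta> where th: "\<theta> \<in> automorphisms W"
    and act: "\<And>z0 z1 z2 z3. coord z0 z1 z2 z3 \<noteq> 0 \<Longrightarrow> \<theta> (pspan (coord z0 z1 z2 z3)) =
      pspan (coord (area u v * s z0 - area u t * s z1 - area v t * s z2 + 0 * s z3)
        (fst u * s z1 + fst v * s z2 + fst t * s z3) (snd u * s z1 + snd v * s z2 + snd t * s z3) (s z3))"
    using semiaffine_automorphism[OF s D, of t 0] by blast
  have s0: "s 0 = 0" using s(2)[of 0 0] unfolding add_0_left add_cancel_right_right .
  have s1: "s 1 = 1"
  proof -
    have "s 1 \<noteq> 0" using bij_is_inj[OF s(1)] s0 by (metis inj_eq zero_neq_one)
    then show ?thesis using s(3)[of 1 1] by simp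
  qed
  have "\<theta> (pspan (coord 1 0 0 0)) = pspan (area u v *s coord 1 0 0 0)"
    by (subst act) (simp_all add: coord_0 coord_scale s0 s1)
  then have "\<theta> x = x" unfolding e0_coord[symmetric] pspan_scale[OF D] .
  then have "\<theta> \<in> aut_stabilizer W x" using th by (simp add: aut_stabilizer_def)
  moreover have "\<theta> (affine_pt p) = affine_pt (k (fst p), area u v * s (snd p) - area u t * s (fst (fst p)) - area v t * s (snd (fst p)))" for p
    unfolding affine_pt_def affine_vec_def using k[of "fst (fst p)" "snd (fst p)"] by (subst act) (simp_all add: coord_0 s1)
  ultimately show ?thesis using that by blast
qed

text \<open>A transvection: it adds \<open>d * z3\<close> to the first coordinate and so fixes every
  point with \<open>z3 = 0\<close>, that is, every point collinear with \<open>x\<close>.\<close>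

lemma vertical_translation:
  obtains \<theta> where "\<theta> \<in> symmetries W x" "\<And>p. \<theta> (affine_pt p) = affine_pt (fst p, snd p + d)"
proof -
  have D: "area (1, 0) (0, 1 :: 'a) \<noteq> 0" by (simp add: area_def)
  have "\<exists>\<theta> \<in> automorphisms W. \<forall>z0 z1 z2 z3. coord z0 z1 z2 z3 \<noteq> 0 \<longrightarrow>
      \<theta> (pspan (coord z0 z1 z2 z3)) = pspan (coord (z0 + d * z3) z1 z2 z3)"
    using semiaffine_automorphism[OF bij_id _ _ D, of "(0, 0)" d] by (simp add: area_def)
  then obtain \<theta> where th: "\<theta> \<in> automorphisms W"
    and act: "\<And>z0 z1 z2 z3. coord z0 z1 z2 z3 \<noteq> 0 \<Longrightarrow> \<theta> (pspan (coord z0 z1 z2 z3)) = pspan (coord (z0 + d * z3) z1 z2 z3)"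
    by blast
  have "\<theta> p = p" if "p \<in> perp W {x}" for p
  proof -
    have "p \<in> pg_points" using that by (simp add: perp_def W_simps)
    then obtain a where a: "a \<noteq> 0" "p = pspan a" by (rule pg_pointE)
    obtain z0 z1 z2 z3 where z: "a = coord z0 z1 z2 z3" by (rule coord_exhaust)
    have z3: "z3 = 0" using that unfolding a(2) perp_x_iff[OF a(1)] unfolding z B_e0 by simp
    show ?thesis using act[of z0 z1 z2 z3] a(1) unfolding a(2) z z3 by simp
  qed
  then have "\<theta> \<in> symmetries W x" using th by (simp add: symmetries_def)
  moreover have "\<theta> (affine_pt p) = affine_pt (fst p, snd p + d)" for p
    unfolding affine_pt_def affine_vec_def by (subst act) (simp_all add: coord_0)
  ultimately show ?thesis using that by blast
qed

section \<open>The actions of the stabilizer\<close>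

abbreviation "stab \<equiv> aut_stabilizer W x"
abbreviation "payne_restrict \<theta> \<equiv> restrict \<theta> (points PQ)"
abbreviation "stab_group \<equiv> (aut_group W)\<lparr>carrier := stab\<rparr>"

lemma stab_automorphism:
  "\<theta> \<in> stab \<Longrightarrow> \<theta> \<in> automorphisms W" and stab_x: "\<theta> \<in> stab \<Longrightarrow> \<theta> x = x"
  by (simp_all add: aut_stabilizer_def)

lemma group_stab: "group stab_group"
proof -
  interpret group "aut_group W" by (rule group_aut_group)
  have "subgroup stab (aut_group W)"
  proof (rule subgroupI)
    show "stab \<subseteq> carrier (aut_group W)" by (auto simp: aut_group_simps aut_stabilizer_def)
    have "\<one>\<^bsub>aut_group W\<^esub> \<in> stab"
      using one_closed x_point unfolding aut_stabilizer_def aut_group_simps by (simp add: W_simps)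
    then show "stab \<noteq> {}" by blast
  next
    fix \<theta> assume th: "\<theta> \<in> stab"
    then have c: "\<theta> \<in> carrier (aut_group W)" by (simp add: aut_group_simps stab_automorphism)
    let ?i = "inv\<^bsub>aut_group W\<^esub> \<theta>"
    have i: "?i \<in> automorphisms W" using inv_closed[OF c] by (simp add: aut_group_simps)
    have "?i \<otimes>\<^bsub>aut_group W\<^esub> \<theta> = \<one>\<^bsub>aut_group W\<^esub>" using c by (rule l_inv)
    then have "compose (points W) ?i \<theta> x = (\<lambda>p\<in>points W. p) x"
      using aut_group_simps(2)[OF i stab_automorphism[OF th]] aut_group_simps(3) by metis
    then have "?i x = x" using x_point stab_x[OF th] by (simp add: compose_def W_simps)
    then show "?i \<in> stab" using i by (simp add: aut_stabilizer_def)
  next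
    fix \<theta> \<eta> assume t: "\<theta> \<in> stab" and e: "\<eta> \<in> stab"
    have "\<theta> \<otimes>\<^bsub>aut_group W\<^esub> \<eta> \<in> automorphisms W"
      using t e m_closed[of \<theta> \<eta>] by (simp add: aut_group_simps(1) stab_automorphism)
    moreover have "(\<theta> \<otimes>\<^bsub>aut_group W\<^esub> \<eta>) x = x"
      using x_point stab_x[OF t] stab_x[OF e]
      by (simp add: aut_group_simps(2) stab_automorphism t e compose_def W_simps)
    ultimately show "\<theta> \<otimes>\<^bsub>aut_group W\<^esub> \<eta> \<in> stab" by (simp add: aut_stabilizer_def)
  qed
  then show ?thesis by (rule subgroup_imp_group)
qed

lemma stab_group_mult:
  "\<theta> \<in> stab \<Longrightarrow> \<eta> \<in> stab \<Longrightarrow> \<theta> \<otimes>\<^bsub>stab_group\<^esub> \<eta> = compose pg_points \<theta> \<eta>"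
  using aut_group_simps(2)[of \<theta> W \<eta>] by (simp add: stab_automorphism W_simps)

lemma stab_group_one: "\<one>\<^bsub>stab_group\<^esub> = (\<lambda>p\<in>pg_points. p)"
  using aut_group_simps(3)[of W] by (simp add: W_simps)

lemma stab_perp:
  "\<theta> \<in> stab \<Longrightarrow> M \<subseteq> pg_points \<Longrightarrow> \<theta> ` perp W M = perp W (\<theta> ` M)"
  using automorphism_perp[OF stab_automorphism] unfolding W_simps by blast

lemma stab_inj: "\<theta> \<in> stab \<Longrightarrow> inj_on \<theta> pg_points"
  using automorphism_bij_betw[OF stab_automorphism] by (simp add: bij_betw_def W_simps)

lemma stab_perp_x: "\<theta> \<in> stab \<Longrightarrow> \<theta> ` perp W {x} = perp W {x}"
  using stab_perp[of \<theta> "{x}"] x_point by (simp add: stab_x)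

lemma stab_perp_x_pt:
  "\<theta> \<in> stab \<Longrightarrow> \<theta> ` perp W {x, affine_pt p} = perp W {x, \<theta> (affine_pt p)}"
  using stab_perp[of \<theta> "{x, affine_pt p}"] x_point affine_pt_point by (simp add: stab_x)

lemma points_PQ_diff: "points PQ = pg_points - perp W {x}"
  by (simp add: payne_derived_def W_simps)

lemma perp_pg: "perp W M \<subseteq> pg_points"
  using perp_subset[of W M] by (simp add: W_simps)

lemma stab_points_PQ: "\<theta> \<in> stab \<Longrightarrow> \<theta> ` points PQ = points PQ"
  unfolding points_PQ_diff
  using inj_on_image_set_diff[OF stab_inj, of \<theta> pg_points "perp W {x}"] perp_pg stab_perp_x
    automorphism_bij_betw[OF stab_automorphism, of \<theta>] by (simp add: bij_betw_def W_simps)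

lemma stab_pt: assumes "\<theta> \<in> stab" obtains r where "\<theta> (affine_pt p) = affine_pt r"
  using stab_points_PQ[OF assms] unfolding points_PQ by blast

lemma stab_base_pt:
  "\<theta> \<in> stab \<Longrightarrow> \<theta> (affine_pt p) = affine_pt r \<Longrightarrow> \<theta> ` base_pt (fst p) = base_pt (fst r)"
  using stab_perp_x_pt[of \<theta> p] by (simp add: perp_x_pt_base_pt)

lemma lines_W_subset: "l \<in> lines W \<Longrightarrow> l \<subseteq> pg_points"
  unfolding lines_W by blast

lemma automorphism_line:
  "\<theta> \<in> automorphisms W \<Longrightarrow> l \<in> lines W \<Longrightarrow> \<theta> ` l \<in> lines W"
proof -
  assume th: "\<theta> \<in> automorphisms W" and l: "l \<in> lines W"
  then obtain f where f: "bij_betw f (lines W) (lines W)"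
      "\<And>p. p \<in> pg_points \<Longrightarrow> p \<in> l \<longleftrightarrow> \<theta> p \<in> f l"
    unfolding automorphisms_def W_simps by blast
  have fl: "f l \<in> lines W" using f(1) l by (rule bij_betw_apply)
  have "pg_points = \<theta> ` pg_points" using automorphism_bij_betw[OF th] by (simp add: bij_betw_def W_simps)
  then have "f l = {p \<in> \<theta> ` pg_points. p \<in> f l}" using lines_W_subset[OF fl] by blast
  also have "\<dots> = \<theta> ` l" using f(2) lines_W_subset[OF l] by blast
  finally show ?thesis using fl by simp
qed

lemma payne_restrict_automorphism:
  assumes th: "\<theta> \<in> stab"
  shows "payne_restrict \<theta> \<in> automorphisms PQ"
proof (rule finite_automorphismI[where f = "\<lambda>l. \<theta> ` l"], unfold inc_PQ)
  have sub: "points PQ \<subseteq> pg_points" unfolding points_PQ_diff by blast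
  have lsub: "l \<subseteq> pg_points" if "l \<in> lines PQ" for l
    using that lines_W_subset perp_pg unfolding lines_PQ by blast
  show "inj_on (payne_restrict \<theta>) (points PQ)"
    using inj_on_subset[OF stab_inj[OF th] sub] by simp
  show "payne_restrict \<theta> ` points PQ \<subseteq> points PQ" using stab_points_PQ[OF th] by auto
  show "inj_on ((`) \<theta>) (lines PQ)"
    by (rule inj_on_image[OF inj_on_subset[OF stab_inj[OF th]]]) (use lsub in blast)
  show "(`) \<theta> ` lines PQ \<subseteq> lines PQ"
  proof (intro image_subsetI)
    fix l assume "l \<in> lines PQ"
    then consider "l \<in> lines W" "x \<notin> l" | p where "l = perp W (perp W {x, affine_pt p}) - {x}"
      unfolding lines_PQ by blast
    then show "\<theta> ` l \<in> lines PQ"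
    proof cases
      case 1
      have "\<theta> x \<notin> \<theta> ` l"
        using inj_on_image_mem_iff[OF stab_inj[OF th] x_point lines_W_subset[OF 1(1)]] 1(2) by simp
      then have "x \<notin> \<theta> ` l" unfolding stab_x[OF th] .
      then show ?thesis using automorphism_line[OF stab_automorphism[OF th] 1(1)] unfolding lines_PQ by blast
    next
      case 2
      obtain r where r: "\<theta> (affine_pt p) = affine_pt r" using stab_pt[OF th] .
      have "\<theta> ` l = \<theta> ` perp W (perp W {x, affine_pt p}) - \<theta> ` {x}"
        unfolding 2 by (rule inj_on_image_set_diff[OF stab_inj[OF th]]) (auto simp: x_point intro: subsetD[OF perp_pg])
      also have "\<dots> = perp W (perp W {x, affine_pt r}) - {x}"
        by (simp add: stab_perp[OF th perp_pg] stab_perp_x_pt[OF th] stab_x[OF th] r)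
      finally show ?thesis unfolding lines_PQ by blast
    qed
  qed
  show "p \<in> l \<longleftrightarrow> payne_restrict \<theta> p \<in> \<theta> ` l" if "p \<in> points PQ" "l \<in> lines PQ" for p l
    using that inj_on_image_mem_iff[OF stab_inj[OF th] _ lsub[OF that(2)], of p] sub by auto
qed auto

lemma plane_action_base_pt: "plane_action W x \<theta> (base_pt P) = \<theta> ` base_pt P"
  unfolding plane_action_def points_PL by simp

lemma plane_action_automorphism:
  assumes th: "\<theta> \<in> stab"
  shows "plane_action W x \<theta> \<in> automorphisms PL"
proof (rule finite_automorphismI[where f = \<theta>], unfold inc_PL)
  have sub: "base_pt P \<subseteq> pg_points" for P using base_pt_perp perp_pg by blast
  have lsub: "lines PL \<subseteq> pg_points" unfolding lines_PL using perp_pg by blast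
  show "plane_action W x \<theta> \<in> extensional (points PL)" unfolding plane_action_def by simp
  show "inj_on (plane_action W x \<theta>) (points PL)"
  proof (rule inj_onI)
    fix m n assume "m \<in> points PL" "n \<in> points PL" "plane_action W x \<theta> m = plane_action W x \<theta> n"
    then show "m = n" unfolding points_PL
      using inj_on_image_eq_iff[OF stab_inj[OF th] sub sub] plane_action_base_pt by fastforce
  qed
  show "plane_action W x \<theta> ` points PL \<subseteq> points PL"
  proof
    fix m assume "m \<in> plane_action W x \<theta> ` points PL"
    then obtain P where m: "m = \<theta> ` base_pt P" unfolding points_PL using plane_action_base_pt by blast
    obtain r where "\<theta> (affine_pt (P, 0)) = affine_pt r" using stab_pt[OF th] .
    from stab_base_pt[OF th this] show "m \<in> points PL" unfolding points_PL m by simp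
  qed
  show "inj_on \<theta> (lines PL)" by (rule inj_on_subset[OF stab_inj[OF th] lsub])
  have "\<theta> ` (perp W {x} - {x}) = \<theta> ` perp W {x} - \<theta> ` {x}"
    by (rule inj_on_image_set_diff[OF stab_inj[OF th]]) (auto simp: x_point intro: subsetD[OF perp_pg])
  then show "\<theta> ` lines PL \<subseteq> lines PL"
    unfolding lines_PL by (simp add: stab_perp_x[OF th] stab_x[OF th])
  show "l \<in> m \<longleftrightarrow> \<theta> l \<in> plane_action W x \<theta> m" if ml: "m \<in> points PL" "l \<in> lines PL" for m l
  proof -
    obtain P where m: "m = base_pt P" using ml(1) unfolding points_PL by blast
    have "l \<in> pg_points" using ml(2) lsub by blast
    then show ?thesis unfolding m plane_action_base_pt
      using inj_on_image_mem_iff[OF stab_inj[OF th] _ sub] by blast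
  qed
qed auto

text \<open>Two points of the affine plane have at most one line in common: both directions
  \<open>(u, v)\<close> and \<open>(u', v')\<close> are proportional to the difference of
  \<open>P\<close> and \<open>R\<close>.\<close>

lemma two_base_points:
  assumes "P \<noteq> R" and y: "y \<in> base_pt P" "y \<in> base_pt R" and y': "y' \<in> base_pt P" "y' \<in> base_pt R"
  shows "y = y'"
proof -
  obtain u v w where uv: "(u, v) \<noteq> (0, 0)" "y = pspan (coord w u v 0)"
    using perp_x_cases[of y] y(1) base_pt_perp x_notin_base_pt by blast
  obtain u' v' w' where uv': "(u', v') \<noteq> (0, 0)" "y' = pspan (coord w' u' v' 0)"
    using perp_x_cases[of y'] y'(1) base_pt_perp x_notin_base_pt by blast
  have m: "coord w u v 0 \<noteq> 0" "coord w' u' v' 0 \<noteq> 0" using uv(1) uv'(1) unfolding coord_0 by auto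
  have w: "w = v * fst P - u * snd P" "w = v * fst R - u * snd R"
    using y unfolding uv(2) base_pt_iff[OF m(1)] by simp_all
  have w': "w' = v' * fst P - u' * snd P" "w' = v' * fst R - u' * snd R"
    using y' unfolding uv'(2) base_pt_iff[OF m(2)] by simp_all
  have d: "v * (fst R - fst P) = u * (snd R - snd P)" "v' * (fst R - fst P) = u' * (snd R - snd P)"
    using w w' by algebra+
  have "u * v' = u' * v"
  proof (cases "fst R = fst P")
    case True
    then have "snd R - snd P \<noteq> 0" using \<open>P \<noteq> R\<close> by (auto simp: prod_eq_iff)
    then show ?thesis using d True by simp
  next
    case False
    have "(u * v' - u' * v) * (fst R - fst P) = 0" using d by algebra
    then show ?thesis using False by simp
  qed
  then obtain c where c: "u' = c * u" "v' = c * v"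
  proof (cases "u = 0")
    case True
    then show ?thesis using uv(1) \<open>u * v' = u' * v\<close> by (intro that[of "v' / v"]) auto
  next
    case False
    then show ?thesis using \<open>u * v' = u' * v\<close> by (intro that[of "u' / u"]) (auto simp: field_simps)
  qed
  have "w' = c * w" unfolding w(1) w'(1) c by (simp add: algebra_simps)
  then have "coord w' u' v' 0 = c *s coord w u v 0" unfolding coord_scale coord_inject using c by simp
  moreover have "c \<noteq> 0" using c uv'(1) by auto
  ultimately show ?thesis unfolding uv(2) uv'(2) by (simp add: pspan_scale)
qed

lemma on_two_base_points:
  assumes "y \<in> perp W {x} - {x}"
  obtains P R where "P \<noteq> R" "y \<in> base_pt P" "y \<in> base_pt R"
proof -
  obtain u v w where uv: "(u, v) \<noteq> (0, 0)" "y = pspan (coord w u v 0)" using assms by (rule perp_x_cases)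
  have m: "coord w u v 0 \<noteq> 0" using uv(1) unfolding coord_0 by auto
  \<comment> \<open>The witnesses are two points on the affine line
    \<open>v * X - u * Y = w\<close>.\<close>
  show ?thesis
  proof (cases "v = 0")
    case True
    then have "u \<noteq> 0" using uv by simp
    then show ?thesis using True
      by (intro that[of "(0, - w / u)" "(1, - w / u)"]) (simp_all add: uv(2) base_pt_iff[OF m[unfolded True]])
  next
    case False
    then show ?thesis
      by (intro that[of "(w / v, 0)" "((w + u) / v, 1)"]) (simp_all add: uv(2) base_pt_iff[OF m])
  qed
qed

text \<open>A point of the perp other than \<open>x\<close> is the only common element of two points
  of the plane, so the images of these two sets determine its image.\<close>

lemma agree_on_perp_x:
  assumes t: "\<theta> \<in> stab" and e: "\<eta> \<in> stab" and eq: "\<And>P. \<theta> ` base_pt P = \<eta> ` base_pt P" and y: "y \<in> perp W {x}"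
  shows "\<theta> y = \<eta> y"
proof (cases "y = x")
  case True
  then show ?thesis by (simp add: stab_x t e)
next
  case False
  then obtain P R where PR: "P \<noteq> R" "y \<in> base_pt P" "y \<in> base_pt R" using on_two_base_points y by blast
  obtain p where p: "\<theta> (affine_pt (P, 0)) = affine_pt p" using stab_pt[OF t] .
  obtain r where r: "\<theta> (affine_pt (R, 0)) = affine_pt r" using stab_pt[OF t] .
  have i: "\<theta> ` base_pt P = base_pt (fst p)" "\<theta> ` base_pt R = base_pt (fst r)" using stab_base_pt[OF t p] stab_base_pt[OF t r] by simp_all
  have "base_pt P \<subseteq> pg_points" "base_pt R \<subseteq> pg_points" using base_pt_perp perp_pg by blast+
  then have "fst p \<noteq> fst r"
    using i inj_on_image_eq_iff[OF stab_inj[OF t], of "base_pt P" "base_pt R"] PR(1) base_pt_inject by auto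
  moreover have "\<theta> y \<in> base_pt (fst p)" "\<theta> y \<in> base_pt (fst r)"
    unfolding i[symmetric] using PR(2,3) by (simp_all add: imageI)
  moreover have "\<eta> y \<in> base_pt (fst p)" "\<eta> y \<in> base_pt (fst r)"
    unfolding i[symmetric] eq using PR(2,3) by (simp_all add: imageI)
  ultimately show ?thesis by (rule two_base_points)
qed

text \<open>Restriction to the derived quadrangle is faithful: the action on affine points gives the
  action on their perps with \<open>x\<close>, hence on the plane and on the remaining
  points.\<close>

lemma stab_eqI:
  assumes t: "\<theta> \<in> stab" and e: "\<eta> \<in> stab" and eq: "\<And>p. \<theta> (affine_pt p) = \<eta> (affine_pt p)"
  shows "\<theta> = \<eta>"
proof
  fix y
  have base_pt: "\<theta> ` base_pt P = \<eta> ` base_pt P" for P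
    using stab_perp_x_pt[OF t, of "(P, 0)"] stab_perp_x_pt[OF e, of "(P, 0)"] eq unfolding perp_x_pt_base_pt by simp
  consider "y \<notin> pg_points" | "y \<in> perp W {x}" | "y \<in> points PQ" unfolding points_PQ_diff by blast
  then show "\<theta> y = \<eta> y"
  proof cases
    case 1
    then show ?thesis
      using automorphism_undefined[OF stab_automorphism[OF t]] automorphism_undefined[OF stab_automorphism[OF e]]
      by (simp add: W_simps)
  next
    case 2
    then show ?thesis using agree_on_perp_x[OF t e base_pt] by blast
  next
    case 3
    then show ?thesis using eq unfolding points_PQ by blast
  qed
qed

section \<open>Automorphisms of the derived quadrangle and of the plane extend to the
  stabilizer\<close>

lemma PQ_automorphism_coords:
  assumes g: "g \<in> automorphisms PQ"
  obtains h where "bij h" "\<And>p. g (affine_pt p) = affine_pt (h p)" "\<And>p r. heis_adj (h p) (h r) \<longleftrightarrow> heis_adj p r"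
proof -
  have "\<exists>r. g (affine_pt p) = affine_pt r" for p
    using automorphism_closed[OF g, of "affine_pt p"] unfolding points_PQ by blast
  then obtain h where h: "\<And>p. g (affine_pt p) = affine_pt (h p)" by metis
  have "inj h"
  proof (rule injI)
    fix p r assume "h p = h r"
    then have "g (affine_pt p) = g (affine_pt r)" using h by simp
    then show "p = r" using automorphism_inj_iff[OF g, of "affine_pt p" "affine_pt r"] affine_pt_inject unfolding points_PQ by blast
  qed
  then have "bij h" by (simp add: bij_def finite_UNIV_inj_surj)
  moreover have "heis_adj (h p) (h r) \<longleftrightarrow> heis_adj p r" for p r
    using automorphism_collinear_in[OF g, of "affine_pt p" "affine_pt r"] unfolding points_PQ h collinear_PQ by blast
  ultimately show ?thesis using that h by blast
qed

lemma kernel_coords: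
  assumes t: "\<theta> \<in> stab" and fix_base_pt: "\<And>P. \<theta> ` base_pt P = base_pt P"
  obtains d where "\<And>p. \<theta> (affine_pt p) = affine_pt (fst p, snd p + d)"
proof -
  obtain h where h: "\<And>p. payne_restrict \<theta> (affine_pt p) = affine_pt (h p)" "\<And>p r. heis_adj (h p) (h r) \<longleftrightarrow> heis_adj p r"
    using PQ_automorphism_coords[OF payne_restrict_automorphism[OF t]] by metis
  have th: "\<theta> (affine_pt p) = affine_pt (h p)" for p using h(1)[of p] unfolding points_PQ by simp
  have "fst (h p) = fst p" for p
    using stab_base_pt[OF t th, of p] fix_base_pt[of "fst p"] base_pt_inject by metis
  then obtain d where "\<And>p. h p = (fst p, snd p + d)"
    using heis_adj_automorphism_over_identity[of h] h(2) by blast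
  then show ?thesis using that th by simp
qed

lemma payne_restrict_surjective:
  assumes q: "CARD('a) \<ge> 5" and g: "g \<in> automorphisms PQ"
  obtains \<theta> where "\<theta> \<in> stab" "payne_restrict \<theta> = g"
proof -
  obtain h where h: "bij h" "\<And>p. g (affine_pt p) = affine_pt (h p)" "\<And>p r. heis_adj (h p) (h r) \<longleftrightarrow> heis_adj p r"
    using PQ_automorphism_coords[OF g] by metis
  obtain k where k: "bij k" "\<And>P R T. collin (k P) (k R) (k T) \<longleftrightarrow> collin P R T" "\<And>p. fst (h p) = k (fst p)"
    using heis_adj_automorphism_induces[OF q h(1,3)] by metis
  obtain \<theta> where th: "\<theta> \<in> stab" "\<And>p. \<exists>c. \<theta> (affine_pt p) = affine_pt (k (fst p), c)"
    using collineation_lift[OF k(1,2)] by metis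
  obtain f where f: "bij f" "\<And>p. payne_restrict \<theta> (affine_pt p) = affine_pt (f p)" "\<And>p r. heis_adj (f p) (f r) \<longleftrightarrow> heis_adj p r"
    using PQ_automorphism_coords[OF payne_restrict_automorphism[OF th(1)]] by metis
  have thf: "\<theta> (affine_pt p) = affine_pt (f p)" for p using f(2)[of p] unfolding points_PQ by simp
  have ff: "fst (f p) = k (fst p)" for p using th(2)[of p] unfolding thf affine_pt_inject by auto
  \<comment> \<open>\<open>g\<close> and the lift \<open>\<theta>\<close> of its base action differ by an automorphism preserving every vertical line\<close>
  define e where "e = inv_into UNIV f \<circ> h"
  have fe: "f (e p) = h p" for p unfolding e_def using f(1) by (simp add: bij_is_surj surj_f_inv_f)
  have "heis_adj (e p) (e r)" if "heis_adj p r" for p r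
    using that f(3)[of "e p" "e r"] h(3)[of p r] unfolding fe by blast
  moreover have "fst (e p) = fst p" for p
  proof -
    have "k (fst (e p)) = k (fst p)" unfolding ff[symmetric] fe k(3) ..
    then show ?thesis using bij_is_inj[OF k(1)] by (simp add: inj_eq)
  qed
  ultimately obtain d where d: "\<And>p. e p = (fst p, snd p + d)"
    using heis_adj_automorphism_over_identity[of e] by blast
  obtain \<tau> where tau: "\<tau> \<in> symmetries W x" "\<And>p. \<tau> (affine_pt p) = affine_pt (fst p, snd p + d)"
    using vertical_translation[where d = d] by blast
  have tA: "\<tau> \<in> stab" using tau(1) x_perp by (simp add: symmetries_def aut_stabilizer_def)
  \<comment> \<open>Since \<open>h = f \<circ> e\<close> with \<open>e\<close> the vertical
    translation, \<open>\<tau>\<close> is applied before \<open>\<theta>\<close>.\<close>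
  let ?z = "compose pg_points \<theta> \<tau>"
  have z: "?z \<in> stab"
    using group.is_monoid[OF group_stab, THEN monoid.m_closed, of \<theta> \<tau>] stab_group_mult[OF th(1) tA] th(1) tA by simp
  have act: "?z (affine_pt p) = g (affine_pt p)" for p
    unfolding compose_eq[OF affine_pt_point] tau(2) thf d[symmetric] fe h(2) ..
  have "payne_restrict ?z = g"
  proof
    fix y
    show "payne_restrict ?z y = g y"
    proof (cases "y \<in> points PQ")
      case True
      then show ?thesis using act unfolding points_PQ by auto
    next
      case False
      then show ?thesis using automorphism_undefined[OF g False] by simp
    qed
  qed
  then show ?thesis using that z by blast
qed

lemma plane_action_surjective:
  assumes k: "k \<in> automorphisms PL"
  obtains \<theta> where "\<theta> \<in> stab" "plane_action W x \<theta> = k"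
proof -
  have "\<exists>R. k (base_pt P) = base_pt R" for P
    using automorphism_closed[OF k, of "base_pt P"] unfolding points_PL by blast
  then obtain f where f: "\<And>P. k (base_pt P) = base_pt (f P)" by metis
  have "inj f"
  proof (rule injI)
    fix P R assume "f P = f R"
    then have "k (base_pt P) = k (base_pt R)" using f by simp
    then show "P = R" using automorphism_inj_iff[OF k, of "base_pt P" "base_pt R"] base_pt_inject unfolding points_PL by blast
  qed
  then have "bij f" by (simp add: bij_def finite_UNIV_inj_surj)
  moreover have "collin (f P) (f R) (f T) \<longleftrightarrow> collin P R T" for P R T
  proof -
    have "collin P R T \<longleftrightarrow> (\<exists>l \<in> lines PL. \<forall>m \<in> base_pt ` {P, R, T}. inc PL (k m) l)"
      unfolding collin_iff_common_line by (rule automorphism_common_line[OF k]) (auto simp: points_PL)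
    also have "\<dots> \<longleftrightarrow> collin (f P) (f R) (f T)"
      unfolding collin_iff_common_line by (simp add: f)
    finally show ?thesis by simp
  qed
  ultimately obtain \<theta> where th: "\<theta> \<in> stab" "\<And>p. \<exists>c. \<theta> (affine_pt p) = affine_pt (f (fst p), c)"
    using collineation_lift by metis
  have "plane_action W x \<theta> = k"
  proof
    fix m
    show "plane_action W x \<theta> m = k m"
    proof (cases "m \<in> points PL")
      case True
      then obtain P where m: "m = base_pt P" unfolding points_PL by blast
      obtain c where "\<theta> (affine_pt (P, 0)) = affine_pt (f P, c)" using th(2)[of "(P, 0)"] by auto
      from stab_base_pt[OF th(1) this] show ?thesis unfolding m plane_action_base_pt f by simp
    next
      case False
      then show ?thesis using automorphism_undefined[OF k False] by (simp add: plane_action_def)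
    qed
  qed
  then show ?thesis using that th(1) by blast
qed

section \<open>The kernel of the plane action and the bijection\<close>

lemma symmetries_stab: "symmetries W x \<subseteq> stab"
  using x_perp unfolding symmetries_def aut_stabilizer_def by blast

text \<open>An element acting trivially on the plane acts there like the identity of the stabilizer,
  so \<open>agree_on_perp_x\<close> makes it fix the perp pointwise.\<close>

lemma symmetries_eq_kernel:
  "symmetries W x = {\<theta> \<in> stab. plane_action W x \<theta> = \<one>\<^bsub>aut_group PL\<^esub>}"
proof (intro equalityI subsetI)
  fix \<theta> assume th: "\<theta> \<in> symmetries W x"
  have "plane_action W x \<theta> m = (\<lambda>m\<in>points PL. m) m" for m
  proof (cases "m \<in> points PL")
    case True
    then obtain P where m: "m = base_pt P" unfolding points_PL by blast
    have "\<forall>y \<in> base_pt P. \<theta> y = y" using th base_pt_perp[of P] unfolding symmetries_def by blast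
    then have "\<theta> ` base_pt P = base_pt P" by simp
    then show ?thesis unfolding m plane_action_base_pt points_PL by simp
  next
    case False
    then show ?thesis by (simp add: plane_action_def)
  qed
  then have "plane_action W x \<theta> = \<one>\<^bsub>aut_group PL\<^esub>" unfolding aut_group_simps by blast
  then show "\<theta> \<in> {\<theta> \<in> stab. plane_action W x \<theta> = \<one>\<^bsub>aut_group PL\<^esub>}" using th symmetries_stab by blast
next
  fix \<theta> assume th: "\<theta> \<in> {\<theta> \<in> stab. plane_action W x \<theta> = \<one>\<^bsub>aut_group PL\<^esub>}"
  have base_pt: "\<theta> ` base_pt P = base_pt P" for P
    using th plane_action_base_pt[of \<theta> P] unfolding aut_group_simps points_PL by simp
  have id: "(\<lambda>p\<in>pg_points. p) \<in> stab"
    using group.is_monoid[OF group_stab, THEN monoid.one_closed] unfolding stab_group_one by simp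
  have "(\<lambda>p\<in>pg_points. p) ` base_pt P = base_pt P" for P
    using base_pt_perp[of P] perp_pg[of "{x}"] by (auto simp: restrict_def subset_iff)
  then have "\<theta> y = y" if "y \<in> perp W {x}" for y
    using agree_on_perp_x[OF _ id, of \<theta> y] th base_pt that perp_pg[of "{x}"] by auto
  then show "\<theta> \<in> symmetries W x" using th by (simp add: symmetries_def stab_automorphism)
qed

text \<open>A symmetry is a translation of the heights by a constant, and one fixed affine point
  makes the constant 0.\<close>

lemma symmetries_free:
  assumes th: "\<theta> \<in> symmetries W x" and p: "\<theta> (affine_pt p) = affine_pt p"
  shows "\<theta> = (\<lambda>p\<in>pg_points. p)"
proof (rule stab_eqI)
  show tA: "\<theta> \<in> stab" using th symmetries_stab by blast
  show "(\<lambda>p\<in>pg_points. p) \<in> stab"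
    using group.is_monoid[OF group_stab, THEN monoid.one_closed] unfolding stab_group_one by simp
  have "\<theta> ` base_pt P = base_pt P" for P
  proof -
    have "\<forall>y \<in> base_pt P. \<theta> y = y" using th base_pt_perp[of P] unfolding symmetries_def by blast
    then show ?thesis by simp
  qed
  then obtain d where d: "\<And>p. \<theta> (affine_pt p) = affine_pt (fst p, snd p + d)" using kernel_coords[OF tA] by blast
  then have "d = 0" using p affine_pt_inject[of "(fst p, snd p + d)" p] by (simp add: prod_eq_iff)
  then show "\<theta> (affine_pt r) = (\<lambda>p\<in>pg_points. p) (affine_pt r)" for r using d affine_pt_point by simp
qed

lemma chi_bij:
  assumes q: "CARD('a) \<ge> 5"
  shows "bij_betw (chi W x) (sharply_transitive_subgroups PL) (singer_groups_with_symmetries W x)"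
proof -
  have ptsA: "\<theta> p \<in> points PQ" if "\<theta> \<in> stab" "p \<in> points PQ" for \<theta> p
    using stab_points_PQ[OF that(1)] that(2) by blast
  have sub: "points PQ \<subseteq> pg_points" unfolding points_PQ_diff by blast
  have mult: "\<theta> \<otimes>\<^bsub>stab_group\<^esub> \<eta> \<in> stab" if "\<theta> \<in> stab" "\<eta> \<in> stab" for \<theta> \<eta>
    using group.is_monoid[OF group_stab, THEN monoid.m_closed, of \<theta> \<eta>] that by simp
  have payne_restrict_mult: "payne_restrict (\<theta> \<otimes>\<^bsub>stab_group\<^esub> \<eta>) p = payne_restrict \<theta> (payne_restrict \<eta> p)" if "\<theta> \<in> stab" "\<eta> \<in> stab" "p \<in> points PQ" for \<theta> \<eta> p
    unfolding stab_group_mult[OF that(1,2)]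
    using that(3) ptsA[OF that(2,3)] subsetD[OF sub that(3)] by (simp add: compose_eq)
  have "bij_betw (\<lambda>K. (\<lambda>\<theta>. payne_restrict \<theta>) ` {\<theta> \<in> carrier stab_group. plane_action W x \<theta> \<in> K})
    {K. subgroup K (aut_group PL) \<and> sharply_transitive_on K (points PL)}
    {H. subgroup H (aut_group PQ) \<and> sharply_transitive_on H (points PQ) \<and> (\<lambda>\<theta>. payne_restrict \<theta>) ` symmetries W x \<subseteq> H}"
  \<comment> \<open>\<open>\<beta>\<close> sends a point of the derived quadrangle to the point of
    the plane that stands for its vertical line.\<close>
  proof (rule sharply_transitive_preimage_bij[where \<beta> = "\<lambda>p. perp W {x, p}"])
    show "group stab_group" "group (aut_group PQ)" "group (aut_group PL)" by (rule group_stab group_aut_group)+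
    show "(\<lambda>\<theta>. payne_restrict \<theta>) \<in> hom stab_group (aut_group PQ)"
    proof (rule homI)
      fix \<theta> \<eta> assume "\<theta> \<in> carrier stab_group" "\<eta> \<in> carrier stab_group"
      then have te: "\<theta> \<in> stab" "\<eta> \<in> stab" by simp_all
      have "payne_restrict (\<theta> \<otimes>\<^bsub>stab_group\<^esub> \<eta>) = compose (points PQ) (payne_restrict \<theta>) (payne_restrict \<eta>)"
      proof
        fix p
        show "payne_restrict (\<theta> \<otimes>\<^bsub>stab_group\<^esub> \<eta>) p = compose (points PQ) (payne_restrict \<theta>) (payne_restrict \<eta>) p"
          using payne_restrict_mult[OF te, of p] by (cases "p \<in> points PQ") (simp_all add: compose_def)
      qed
      then show "payne_restrict (\<theta> \<otimes>\<^bsub>stab_group\<^esub> \<eta>) = payne_restrict \<theta> \<otimes>\<^bsub>aut_group PQ\<^esub> payne_restrict \<eta>"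
        using aut_group_simps(2)[OF payne_restrict_automorphism[OF te(1)] payne_restrict_automorphism[OF te(2)]] by simp
    qed (simp add: aut_group_simps payne_restrict_automorphism)
    show "bij_betw (\<lambda>\<theta>. payne_restrict \<theta>) (carrier stab_group) (carrier (aut_group PQ))"
    proof (rule bij_betw_imageI)
      show "inj_on (\<lambda>\<theta>. payne_restrict \<theta>) (carrier stab_group)"
      proof (rule inj_onI)
        fix \<theta> \<eta> assume te: "\<theta> \<in> carrier stab_group" "\<eta> \<in> carrier stab_group" "payne_restrict \<theta> = payne_restrict \<eta>"
        have "\<theta> (affine_pt p) = \<eta> (affine_pt p)" for p
          using fun_cong[OF te(3), of "affine_pt p"] by (simp add: points_PQ)
        then show "\<theta> = \<eta>" using te(1,2) stab_eqI by simp
      qed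
      show "(\<lambda>\<theta>. payne_restrict \<theta>) ` carrier stab_group = carrier (aut_group PQ)"
      proof (intro equalityI subsetI)
        fix g assume "g \<in> carrier (aut_group PQ)"
        then obtain \<theta> where "\<theta> \<in> stab" "payne_restrict \<theta> = g" using payne_restrict_surjective[OF q] unfolding aut_group_simps by blast
        then show "g \<in> (\<lambda>\<theta>. payne_restrict \<theta>) ` carrier stab_group" by auto
      qed (auto simp: aut_group_simps payne_restrict_automorphism)
    qed
    show "plane_action W x \<in> hom stab_group (aut_group PL)"
    proof (rule homI)
      fix \<theta> \<eta> assume "\<theta> \<in> carrier stab_group" "\<eta> \<in> carrier stab_group"
      then have te: "\<theta> \<in> stab" "\<eta> \<in> stab" by simp_all
      have "plane_action W x (\<theta> \<otimes>\<^bsub>stab_group\<^esub> \<eta>) = compose (points PL) (plane_action W x \<theta>) (plane_action W x \<eta>)"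
      proof
        fix m
        show "plane_action W x (\<theta> \<otimes>\<^bsub>stab_group\<^esub> \<eta>) m = compose (points PL) (plane_action W x \<theta>) (plane_action W x \<eta>) m"
        proof (cases "m \<in> points PL")
          case True
          then obtain P where m: "m = base_pt P" unfolding points_PL by blast
          obtain r where "\<eta> (affine_pt (P, 0)) = affine_pt r" using stab_pt[OF te(2)] .
          from stab_base_pt[OF te(2) this] have r: "\<eta> ` base_pt P = base_pt (fst r)" by simp
          have "(\<theta> \<otimes>\<^bsub>stab_group\<^esub> \<eta>) ` base_pt P = \<theta> ` \<eta> ` base_pt P"
            using base_pt_perp[of P] perp_pg[of "{x}"] unfolding stab_group_mult[OF te] image_image
            by (intro image_cong) (auto simp: compose_def)
          then show ?thesis
            unfolding compose_eq[OF True] unfolding m plane_action_base_pt r .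
        next
          case False
          then show ?thesis by (simp add: plane_action_def compose_def)
        qed
      qed
      then show "plane_action W x (\<theta> \<otimes>\<^bsub>stab_group\<^esub> \<eta>) = plane_action W x \<theta> \<otimes>\<^bsub>aut_group PL\<^esub> plane_action W x \<eta>"
        using aut_group_simps(2)[OF plane_action_automorphism[OF te(1)] plane_action_automorphism[OF te(2)]] by simp
    qed (simp add: aut_group_simps plane_action_automorphism)
    show "plane_action W x ` carrier stab_group = carrier (aut_group PL)"
    proof (intro equalityI subsetI)
      fix k assume "k \<in> carrier (aut_group PL)"
      then obtain \<theta> where "\<theta> \<in> stab" "plane_action W x \<theta> = k"
        using plane_action_surjective unfolding aut_group_simps by blast
      then show "k \<in> plane_action W x ` carrier stab_group" by auto
    qed (auto simp: aut_group_simps plane_action_automorphism)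
    show "payne_restrict \<theta> p \<in> points PQ" if "\<theta> \<in> carrier stab_group" "p \<in> points PQ" for \<theta> p
      using that ptsA by simp
    show "payne_restrict (\<theta> \<otimes>\<^bsub>stab_group\<^esub> \<eta>) p = payne_restrict \<theta> (payne_restrict \<eta> p)"
      if "\<theta> \<in> carrier stab_group" "\<eta> \<in> carrier stab_group" "p \<in> points PQ" for \<theta> \<eta> p
      using that payne_restrict_mult by simp
    show "payne_restrict \<one>\<^bsub>stab_group\<^esub> p = p" if "p \<in> points PQ" for p
      using that sub unfolding stab_group_one by auto
    show "perp W {x, payne_restrict \<theta> p} = plane_action W x \<theta> (perp W {x, p})"
      if "\<theta> \<in> carrier stab_group" "p \<in> points PQ" for \<theta> p
    proof -
      from that(2) obtain r where p: "p = affine_pt r" unfolding points_PQ by blast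
      have "\<theta> \<in> stab" using that(1) by simp
      from stab_perp_x_pt[OF this, of r] show ?thesis
        using that(2) unfolding p perp_x_pt_base_pt[of r] plane_action_base_pt by simp
    qed
    show "symmetries W x = {\<theta> \<in> carrier stab_group. plane_action W x \<theta> = \<one>\<^bsub>aut_group PL\<^esub>}"
      using symmetries_eq_kernel by simp
    show "(\<lambda>p. perp W {x, p}) ` points PQ = points PL"
      by (auto simp: plane_at_def payne_derived_def)
    show "\<theta> = \<one>\<^bsub>stab_group\<^esub>" if "\<theta> \<in> symmetries W x" "p \<in> points PQ" "payne_restrict \<theta> p = p" for \<theta> p
    proof -
      from that(2) obtain r where p: "p = affine_pt r" unfolding points_PQ by blast
      show ?thesis unfolding stab_group_one
        by (rule symmetries_free[OF that(1), of r]) (use that(2,3) p in simp)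
    qed
    show "\<exists>\<theta> \<in> symmetries W x. payne_restrict \<theta> p = r"
      if pr: "p \<in> points PQ" "r \<in> points PQ" "perp W {x, p} = perp W {x, r}" for p r
    proof -
      from pr(1,2) obtain a b where ab: "p = affine_pt a" "r = affine_pt b" unfolding points_PQ by blast
      have f: "fst a = fst b" using pr(3) unfolding ab perp_x_pt_base_pt base_pt_inject .
      obtain \<theta> where th: "\<theta> \<in> symmetries W x" "\<And>p. \<theta> (affine_pt p) = affine_pt (fst p, snd p + (snd b - snd a))"
        using vertical_translation[where d = "snd b - snd a"] by blast
      have "payne_restrict \<theta> p = r" using pr(1) th(2)[of a] f unfolding ab by (simp add: prod_eq_iff)
      then show ?thesis using th(1) by blast
    qed
  qed
  moreover have "chi W x = (\<lambda>K. (\<lambda>\<theta>. payne_restrict \<theta>) ` {\<theta> \<in> carrier stab_group. plane_action W x \<theta> \<in> K})"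
    by (rule ext) (simp add: chi_def induced_on_payne_def full_preimage_def)
  moreover have "sharply_transitive_subgroups PL =
      {K. subgroup K (aut_group PL) \<and> sharply_transitive_on K (points PL)}"
    by (simp add: sharply_transitive_subgroups_def)
  moreover have "singer_groups_with_symmetries W x =
      {H. subgroup H (aut_group PQ) \<and> sharply_transitive_on H (points PQ) \<and> (\<lambda>\<theta>. payne_restrict \<theta>) ` symmetries W x \<subseteq> H}"
    by (simp add: singer_groups_with_symmetries_def sharply_transitive_subgroups_def induced_on_payne_def conj_assoc)
  ultimately show ?thesis by simp
qed

end

text \<open>Complete \<open>e0\<close> to a hyperbolic pair with \<open>e3\<close>, project to the
  orthogonal complement of the plane they span, and choose a second pair there; the complement is
  nonzero because 4 exceeds 2.\<close>

lemma symplectic_frame_exists: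
  fixes B :: "'a::{field,finite} ^ 4 \<Rightarrow> 'a ^ 4 \<Rightarrow> 'a"
  assumes symp: "symplectic_form B" and e0: "e0 \<noteq> 0"
  obtains e1 e2 e3 where "symplectic_frame B e0 e1 e2 e3"
proof -
  note bilinear = symplectic_form_bilinear[OF symp] and self = symplectic_form_self[OF symp]
    and skew = symplectic_form_skew[OF symp]
  have partner: "\<exists>v. B u v = 1" if "u \<noteq> 0" for u
  proof -
    have "(\<forall>v. B u v = 0) \<longrightarrow> u = 0" using symp unfolding symplectic_form_def by blast
    with that have "\<exists>v. B u v \<noteq> 0" by blast
    then obtain v where "B u v \<noteq> 0" ..
    then have "B u (inverse (B u v) *s v) = 1" by (simp add: bilinear)
    then show ?thesis by blast
  qed
  obtain e3 where e3: "B e0 e3 = 1" using partner[OF e0] by blast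
  define proj where "proj w = w + (- B w e3) *s e0 + B w e0 *s e3" for w
  have e30: "B e3 e0 = - 1" unfolding skew[of e3 e0] e3 by (rule refl)
  have p: "B (proj w) e0 = 0" "B (proj w) e3 = 0" for w
    unfolding proj_def bilinear self e3 e30 by simp_all
  have "\<exists>w. proj w \<noteq> 0"
  proof (rule ccontr)
    assume "\<nexists>w. proj w \<noteq> 0"
    then have n: "proj w = 0" for w by blast
    have "w = B w e3 *s e0 + (- B w e0) *s e3" for w
    proof -
      have "w + (- B w e3) *s e0 + B w e0 *s e3 = 0" using n[of w] unfolding proj_def .
      then show ?thesis by (simp add: algebra_simps eq_neg_iff_add_eq_0)
    qed
    then have "w \<in> vec.span {e0, e3}" for w unfolding span_pair by blast
    then have "vec.span {e0, e3} = (UNIV :: ('a ^ 4) set)" by blast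
    then have "vec.dim (UNIV :: ('a ^ 4) set) \<le> card {e0, e3}" by (intro vec.dim_le_card) auto
    also have "\<dots> \<le> 2" by (simp add: card_insert_if)
    finally show False by (simp only: vec_dim_card) simp
  qed
  then obtain w where w: "proj w \<noteq> 0" by blast
  obtain z where z: "B (proj w) z = 1" using partner[OF w] by blast
  \<comment> \<open>Projecting \<open>z\<close> changes it only by multiples of \<open>e0\<close>
    and \<open>e3\<close>, which are orthogonal to \<open>proj w\<close>.\<close>
  have "B (proj w) (proj z) = 1"
    unfolding proj_def[of z] bilinear p z by simp
  moreover have "B e0 (proj v) = 0" for v unfolding skew[of e0 "proj v"] p by simp
  ultimately have "symplectic_frame B e0 (proj w) (proj z) e3"
    using symp e3 p by unfold_locales simp_all
  then show ?thesis by (rule that)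
qed

theorem theorem4p1:
  fixes B :: "'a::{field, finite} ^ 4 \<Rightarrow> 'a ^ 4 \<Rightarrow> 'a"
    and x :: "('a ^ 4) set"
    and q :: nat
  assumes "CARD('a) = q" and "odd q" and "q \<ge> 5"
    and "symplectic_form B"
    and "x \<in> points (symplectic_quadrangle B)"
  shows "bij_betw (chi (symplectic_quadrangle B) x)
           (sharply_transitive_subgroups (plane_at (symplectic_quadrangle B) x))
           (singer_groups_with_symmetries (symplectic_quadrangle B) x)"
proof -
  have "x \<in> pg_points" using assms(5) by (simp add: symplectic_quadrangle_def)
  then obtain e0 where e0: "e0 \<noteq> 0" "x = pspan e0" by (rule pg_pointE)
  obtain e1 e2 e3 where "symplectic_frame B e0 e1 e2 e3"
    using symplectic_frame_exists[OF assms(4) e0(1)] by blast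
  then show ?thesis unfolding e0(2) using symplectic_frame.chi_bij assms(1,3) by blast
qed

end
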